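(* Let $\mathcal{V}$ be a trivial spectrum linear subspace of $\operatorname{M}_n(\mathbb{K})$, where $\mathbb{K}$ is an arbitrary field. Then $$\dim \mathcal{V} \leq \frac{n(n-1)}{2}.$$ If equality holds in this inequality, with $\# \mathbb{K} \geq 3$ and $\mathcal{V}$ irreducible, then $\mathcal{V} = P\operatorname{A}_n(\mathbb{K})$ for some $P \in \operatorname{GL}_n(\mathbb{K})$.
   Context: Here $n \geq 1$ is an integer, $\mathbb{K}$ is an arbitrary field (finite or infinite, of any characteristic) and $\# \mathbb{K}$ is its cardinality. $\operatorname{M}_n(\mathbb{K})$, $\operatorname{A}_n(\mathbb{K})$ and $\operatorname{GL}_n(\mathbb{K})$ denote, respectively, the sets of all $n \times n$ matrices, all $n \times n$ alternating matrices (skew-symmetric matrices with all diagonal entries zero), and all $n\times n$ invertible matrices with entries in $\mathbb{K}$. For $P \in \operatorname{GL}_n(\mathbb{K})$, $P\operatorname{A}_n(\mathbb{K}) := \{PA \mid A \in \operatorname{A}_n(\mathbb{K})\}$. A linear subspace $\mathcal{V}$ of $\operatorname{M}_n(\mathbb{K})$ is called a trivial spectrum subspace if no matrix of $\mathcal{V}$ has a non-zero eigenvalue in $\mathbb{K}$. A linear subspace $\mathcal{V}$ of $\operatorname{M}_n(\mathbb{K})$ is called irreducible if no proper non-zero linear subspace of $\mathbb{K}^n$ is globally invariant under all the elements of $\mathcal{V}$. *)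

theory Defs
  imports "Jordan_Normal_Form.Char_Poly" "Jordan_Normal_Form.VS_Connect"
begin

abbreviation mat_subspace :: "nat \<Rightarrow> 'a :: field mat set \<Rightarrow> bool" where
  "mat_subspace n V \<equiv> VectorSpace.subspace class_ring V (module_mat TYPE('a) n n)"

abbreviation vec_subspace :: "nat \<Rightarrow> 'a :: field vec set \<Rightarrow> bool" where
  "vec_subspace n W \<equiv> VectorSpace.subspace class_ring W (module_vec TYPE('a) n)"

abbreviation mat_subspace_dim :: "nat \<Rightarrow> 'a :: field mat set \<Rightarrow> nat" where
  "mat_subspace_dim n V \<equiv>
     vectorspace.dim class_ring ((module_mat TYPE('a) n n)\<lparr>carrier := V\<rparr>)"

text \<open>Eigenvalues are taken in the ground field itself, not in an algebraic closure.\<close>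

definition trivial_spectrum :: "'a :: field mat set \<Rightarrow> bool" where
  "trivial_spectrum V \<longleftrightarrow> (\<forall>A\<in>V. \<not> (\<exists>k. k \<noteq> 0 \<and> eigenvalue A k))"

definition irreducible_mats :: "nat \<Rightarrow> 'a :: field mat set \<Rightarrow> bool" where
  "irreducible_mats n V \<longleftrightarrow>
     \<not> (\<exists>W. vec_subspace n W \<and> W \<noteq> {0\<^sub>v n} \<and> W \<noteq> carrier_vec n \<and>
           (\<forall>A\<in>V. \<forall>x\<in>W. A *\<^sub>v x \<in> W))"

text \<open>The diagonal condition is implied by skew-symmetry only when 2 is nonzero in the field.\<close>

definition alternating_mats :: "nat \<Rightarrow> 'a :: field mat set" where
  "alternating_mats n =
     {A \<in> carrier_mat n n. transpose_mat A = - A \<and> (\<forall>i<n. A $$ (i, i) = 0)}"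

end

theory Submission
  imports Defs "HOL-Library.Function_Algebras"
begin

text \<open>A minimal-cycle argument shows that the vectors \<open>x\<close> spanning the image of some rank-one
  operator in \<open>V\<close> never contain a basis.  If \<open>x\<close> is not such a vector, then the operators in \<open>V\<close>
  killing \<open>x\<close> act faithfully on the quotient by \<open>x\<close>, while \<open>x\<close> is not in \<open>V x\<close>; induction gives
  the bound.

  In the case of equality \<open>V x\<close> is a hyperplane \<open>G\<close>, the kernel of a functional \<open>\<phi>\<close> with
  \<open>\<phi> x = 1\<close>, and the space \<open>W\<close> of operators in \<open>V\<close> killing \<open>x\<close> is again extremal.  Comparing the
  functionals that annihilate \<open>V u\<close> for four points \<open>u\<close> of a projective line through \<open>x\<close> (this
  needs three scalars) shows that \<open>\<beta> h (M x) = - \<phi> (M h)\<close> defines a bilinear form on \<open>G\<close>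
  with \<open>\<beta> h (N h) = 0\<close> for all \<open>N\<close> in \<open>W\<close>.  A dimension count shows that \<open>W\<close> contains
  all operators mapping \<open>G\<close> into the right radical of \<open>\<beta>\<close> and killing both \<open>x\<close> and that radical;
  this makes the radical invariant under \<open>V\<close>, hence zero.  Finally \<open>\<beta>\<close> extends to a form \<open>b\<close> with
  \<open>b u (M u) = 0\<close> for all \<open>M\<close> in \<open>V\<close>, and its matrix is the inverse of \<open>P\<close>.\<close>

section \<open>Dimension bounds for subspaces\<close>

text \<open>If V = P A_n, then b(u, v) = u^T P^(-1) v satisfies b(u, M u) = 0 for all M in V, so
  b(u, -) annihilates V u and depends linearly on u. The proof rebuilds such a b from V alone:
  \<open>\<phi>\<close> plays the role of b(x, -), and polarising at x and h gives b(h, M x) = -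
  b(x, M h), which is the origin of the formula for \<open>\<beta>\<close>. The one block left, b(h,
  x) for h in \<open>G\<close>, is found last, as \<open>\<theta>\<close>. The obstacle is that
  extremality of the compressed space gives information only at vectors h adapted to it, and these
  are known only to include the complement of a proper subspace of \<open>G\<close>. Linear
  identities extend from there at once, but alternation is quadratic in h, so its extension also
  consumes a third scalar: over the field with two elements t and t^2 agree.\<close>

text \<open>Definitions made in \<open>vector_space\<close> itself would be shadowed by their instances
  under the global interpretation \<open>real_vector\<close>.\<close>

locale vspace = vector_space
begin

text \<open>Dimension is handled through upper bounds alone, for arbitrary sets. A lower bound
  \<open>l\<close> is expressed as: every \<open>k\<close> with \<open>dim_at_most S k\<close>
  satisfies \<open>l \<le> k\<close>.\<close>

definition dim_at_most :: "'b set \<Rightarrow> nat \<Rightarrow> bool" where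
  "dim_at_most S k \<longleftrightarrow> (\<exists>B. finite B \<and> card B \<le> k \<and> S \<subseteq> span B)"

lemma dim_at_mostI: "finite B \<Longrightarrow> card B \<le> k \<Longrightarrow> S \<subseteq> span B \<Longrightarrow> dim_at_most S k"
  by (auto simp: dim_at_most_def)

lemma dim_at_most_subset: "dim_at_most T k \<Longrightarrow> S \<subseteq> T \<Longrightarrow> dim_at_most S k"
  by (auto simp: dim_at_most_def)

lemma dim_at_most_mono: "dim_at_most S k \<Longrightarrow> k \<le> l \<Longrightarrow> dim_at_most S l"
  by (auto simp: dim_at_most_def intro: le_trans)

lemma dim_at_most_zero_iff: "dim_at_most S 0 \<longleftrightarrow> S \<subseteq> {0}"
  by (auto simp: dim_at_most_def intro!: exI[of _ "{}"])

lemma dim_at_most_basis: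
  assumes "subspace S" "dim_at_most S k"
  obtains B where "finite B" "card B \<le> k" "independent B" "span B = S"
proof -
  obtain T where T: "finite T" "card T \<le> k" "S \<subseteq> span T"
    using assms(2) by (auto simp: dim_at_most_def)
  obtain B where B: "B \<subseteq> S" "independent B" "S \<subseteq> span B"
    using maximal_independent_subset by blast
  have "finite B \<and> card B \<le> card T"
    using independent_span_bound[OF T(1) B(2)] B(1) T(3) by blast
  moreover have "span B = S"
    using B span_minimal[OF B(1) assms(1)] by blast
  ultimately show ?thesis using that B T by auto
qed

lemma independent_card_le:
  assumes "independent B" "B \<subseteq> S" "dim_at_most S k"
  shows "finite B" "card B \<le> k"
proof -
  obtain T where T: "finite T" "card T \<le> k" "S \<subseteq> span T"
    using assms(3) by (auto simp: dim_at_most_def)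
  have "finite B \<and> card B \<le> card T"
    using independent_span_bound[OF T(1) assms(1)] assms(2) T(3) by blast
  then show "finite B" "card B \<le> k" using T by auto
qed

lemma dim_at_most_psubset:
  assumes "subspace S" "S \<subset> T" "dim_at_most T k"
  shows "\<exists>j. k = Suc j \<and> dim_at_most S j"
proof -
  have "dim_at_most S k" using assms dim_at_most_subset by blast
  then obtain B where B: "finite B" "independent B" "span B = S"
    using dim_at_most_basis assms(1) by metis
  obtain u where u: "u \<in> T" "u \<notin> S" using assms(2) by blast
  have "independent (insert u B)" using B u by (simp add: independent_insertI)
  moreover have "insert u B \<subseteq> T" using B u assms(2) span_superset by blast
  ultimately have "card (insert u B) \<le> k" using independent_card_le assms(3) by blast
  moreover have "u \<notin> B" using u B span_base by blast
  ultimately have "Suc (card B) \<le> k" using B(1) by simp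
  then obtain j where "k = Suc j" "card B \<le> j" by (cases k) auto
  then show ?thesis using B dim_at_mostI by blast
qed

lemma dim_at_most_insert:
  assumes "dim_at_most S k"
  shows "dim_at_most {v. \<exists>a. v - scale a u \<in> S} (Suc k)"
proof -
  obtain T where T: "finite T" "card T \<le> k" "S \<subseteq> span T"
    using assms by (auto simp: dim_at_most_def)
  show ?thesis
  proof (rule dim_at_mostI)
    show "finite (insert u T)" using T by simp
    show "card (insert u T) \<le> Suc k" using T by (simp add: card_insert_if)
    show "{v. \<exists>a. v - scale a u \<in> S} \<subseteq> span (insert u T)"
      using T by (auto simp: span_insert)
  qed
qed

lemma subspace_adjoin:
  assumes "subspace S"
  shows "subspace {v. \<exists>a. v - scale a u \<in> S}"
proof (rule subspaceI)
  show "0 \<in> {v. \<exists>a. v - scale a u \<in> S}"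
    using subspace_0[OF assms] by (auto intro: exI[of _ 0])
next
  fix v w assume "v \<in> {v. \<exists>a. v - scale a u \<in> S}" "w \<in> {v. \<exists>a. v - scale a u \<in> S}"
  then obtain a b where "v - scale a u \<in> S" "w - scale b u \<in> S" by blast
  then have "(v - scale a u) + (w - scale b u) \<in> S" using subspace_add[OF assms] by blast
  then show "v + w \<in> {v. \<exists>a. v - scale a u \<in> S}"
    by (auto simp: algebra_simps intro!: exI[of _ "a + b"])
next
  fix c v assume "v \<in> {v. \<exists>a. v - scale a u \<in> S}"
  then obtain a where "v - scale a u \<in> S" by blast
  then have "scale c (v - scale a u) \<in> S" using subspace_scale[OF assms] by blast
  then show "scale c v \<in> {v. \<exists>a. v - scale a u \<in> S}"
    by (auto simp: algebra_simps intro!: exI[of _ "c * a"])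
qed

text \<open>A vector \<open>v\<close> outside S + K u would give two strict inclusions S \<subset> S
  + K u \<subset> U, but the bounds \<open>k\<close> and \<open>Suc k\<close> leave room for only
  one.\<close>

lemma complement_hyperplane:
  assumes "subspace S" "S \<subseteq> U" "subspace U" "dim_at_most U (Suc k)" "u \<in> U" "u \<notin> S"
    and "\<And>j. dim_at_most S j \<Longrightarrow> k \<le> j" and "v \<in> U"
  shows "\<exists>a. v - scale a u \<in> S"
proof (rule ccontr)
  let ?T = "{v. \<exists>a. v - scale a u \<in> S}"
  assume v: "\<not> ?thesis"
  have "?T \<subset> U"
  proof
    show "?T \<subseteq> U"
    proof
      fix w assume "w \<in> ?T"
      then obtain a where "w - scale a u \<in> U" using assms(2) by blast
      then have "(w - scale a u) + scale a u \<in> U"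
        using assms(3,5) subspace_add subspace_scale by blast
      then show "w \<in> U" by simp
    qed
    have "v \<notin> ?T" using v by simp
    then show "?T \<noteq> U" using assms(8) by metis
  qed
  then obtain j where j: "Suc k = Suc j" "dim_at_most ?T j"
    using dim_at_most_psubset[OF subspace_adjoin[OF assms(1)] _ assms(4)] by iprover
  have "S \<subset> ?T"
  proof
    show "S \<subseteq> ?T" by (auto intro: exI[of _ 0])
    have "u \<in> ?T" using subspace_0[OF assms(1)] by (auto intro: exI[of _ 1])
    then show "S \<noteq> ?T" using assms(6) by metis
  qed
  then obtain i where "j = Suc i" "dim_at_most S i"
    using dim_at_most_psubset[OF assms(1) _ j(2)] by iprover
  then show False using assms(7)[of i] j by simp
qed

lemma complement_codim_two:
  assumes Y: "subspace Y" "Y \<subseteq> U" and U: "subspace U" "dim_at_most U (Suc (Suc k))"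
    and Yk: "\<And>j. dim_at_most Y j \<Longrightarrow> k \<le> j"
  obtains u v where "u \<in> U" "v \<in> U" "\<And>w. w \<in> U \<Longrightarrow> \<exists>a b. w - scale a u - scale b v \<in> Y"
proof (cases "Y = U")
  case True
  show ?thesis
    by (rule that[of 0 0]) (use True subspace_0[OF U(1)] in auto)
next
  case False
  then obtain u where u: "u \<in> U" "u \<notin> Y" using Y by blast
  let ?T = "{v. \<exists>a. v - scale a u \<in> Y}"
  have TU: "?T \<subseteq> U"
  proof
    fix w assume "w \<in> ?T"
    then obtain a where "w - scale a u \<in> U" using Y by blast
    then have "(w - scale a u) + scale a u \<in> U"
      using u U(1) subspace_add subspace_scale by blast
    then show "w \<in> U" by simp
  qed
  have psub: "Y \<subset> ?T"
  proof
    show "Y \<subseteq> ?T" by (auto intro: exI[of _ 0])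
    have "u \<in> ?T" using subspace_0[OF Y(1)] by (auto intro: exI[of _ 1])
    then show "Y \<noteq> ?T" using u by metis
  qed
  have Tk: "Suc k \<le> j" if "dim_at_most ?T j" for j
    using dim_at_most_psubset[OF Y(1) psub that] Yk Suc_le_mono by blast
  show ?thesis
  proof (cases "?T = U")
    case True
    show ?thesis
      by (rule that[of u 0]) (use True u subspace_0[OF U(1)] in auto)
  next
    case False
    then obtain v where v: "v \<in> U" "v \<notin> ?T" using TU by blast
    have ab: "\<exists>a b. w - scale a u - scale b v \<in> Y" if w: "w \<in> U" for w
    proof -
      have "\<exists>b. w - scale b v \<in> ?T"
        by (rule complement_hyperplane[OF subspace_adjoin[OF Y(1)] TU U v Tk w])
      then obtain b a where "w - scale b v - scale a u \<in> Y" by auto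
      then have "w - scale a u - scale b v \<in> Y" by (simp only: diff_diff_eq add.commute)
      then show ?thesis by iprover
    qed
    show ?thesis by (rule that[OF u(1) v(1) ab])
  qed
qed

lemma exists_complement_functional:
  assumes "subspace S" "u \<notin> S"
  obtains f where "Vector_Spaces.linear scale (*) f" "f u = 1" "\<And>s. s \<in> S \<Longrightarrow> f s = 0"
proof -
  interpret K: vector_space "(*) :: 'a \<Rightarrow> 'a \<Rightarrow> 'a"
    by unfold_locales (simp_all add: algebra_simps)
  interpret P: vector_space_pair scale "(*) :: 'a \<Rightarrow> 'a \<Rightarrow> 'a" ..
  obtain B where B: "B \<subseteq> S" "independent B" "S \<subseteq> span B"
    using maximal_independent_subset by blast
  then have sB: "span B = S" using span_minimal[OF B(1) assms(1)] by blast
  have "independent (insert u B)" using B sB assms by (simp add: independent_insertI)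
  then obtain f where f: "Vector_Spaces.linear scale (*) f"
      "\<And>x. x \<in> insert u B \<Longrightarrow> f x = (if x = u then 1 else 0)"
    using P.linear_independent_extend[of "insert u B" "\<lambda>x. if x = u then 1 else 0"] by blast
  have "u \<notin> B" using B assms by blast
  then have "f x = 0" if "x \<in> B" for x using f(2) that by auto
  then have "f s = 0" if "s \<in> S" for s
    using P.linear_eq_0_on_span[OF f(1)] that sB by blast
  then show ?thesis using that f by simp
qed

text \<open>Every \<open>h\<close> in \<open>S\<close> is the difference of \<open>h + g\<close> and
  \<open>g\<close>, so a linear identity known outside \<open>H\<close> extends to all of
  \<open>S\<close>.\<close>

lemma outside_proper_subspace_spans:
  assumes "subspace S" "subspace H" "g \<in> S" "g \<notin> H" "h \<in> S"
  shows "h \<notin> H \<or> h + g \<notin> H"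
  using assms by (metis add_diff_cancel_left' subspace_diff)

end

locale vspace_pair = vs1: vspace s1 + vs2: vspace s2
  for s1 :: "'a::field \<Rightarrow> 'b::ab_group_add \<Rightarrow> 'b"
  and s2 :: "'a \<Rightarrow> 'c::ab_group_add \<Rightarrow> 'c"
begin

sublocale vector_space_pair s1 s2 ..

text \<open>Linearity of \<open>f\<close> is asked on \<open>V\<close> only, since later maps built
  from the form \<open>\<beta>\<close> are linear only where the arguments of \<open>\<beta>\<close>
  lie in \<open>G\<close>. Preimages of a basis of the image, joined with a spanning set of the
  kernel, span \<open>V\<close>.\<close>

lemma rank_nullity_bound:
  assumes V: "vs1.subspace V"
    and add: "\<And>u v. u \<in> V \<Longrightarrow> v \<in> V \<Longrightarrow> f (u + v) = f u + f v"
    and sc: "\<And>c v. v \<in> V \<Longrightarrow> f (s1 c v) = s2 c (f v)"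
    and im: "vs2.dim_at_most (f ` V) a" and ker: "vs1.dim_at_most {v \<in> V. f v = 0} b"
  shows "vs1.dim_at_most V (a + b)"
proof -
  have "vs2.subspace (f ` V)"
  proof (rule vs2.subspaceI)
    have "f (s1 0 0) = s2 0 (f 0)" using sc vs1.subspace_0[OF V] by blast
    then show "0 \<in> f ` V" using vs1.subspace_0[OF V] by (metis image_eqI vs1.scale_zero_right vs2.scale_zero_left)
  next
    show "x + y \<in> f ` V" if "x \<in> f ` V" "y \<in> f ` V" for x y
      using that by (smt (verit, best) add image_iff vs1.subspace_add[OF V])
    show "s2 c x \<in> f ` V" if "x \<in> f ` V" for c x
      using that by (smt (verit, best) sc image_iff vs1.subspace_scale[OF V])
  qed
  then obtain C where C: "finite C" "card C \<le> a" "vs2.span C = f ` V"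
    using vs2.dim_at_most_basis im by metis
  have "C \<subseteq> f ` V" using C vs2.span_superset by blast
  then obtain A where A: "A \<subseteq> V" "finite A" "C = f ` A" "card A = card C"
    by (metis C(1) card_image finite_image_iff subset_image_inj)
  obtain B where B: "finite B" "card B \<le> b" "{v \<in> V. f v = 0} \<subseteq> vs1.span B"
    using ker by (auto simp: vs1.dim_at_most_def)
  have fA: "\<exists>w \<in> vs1.span A. f w = y" if "y \<in> vs2.span (f ` A)" for y
    using that
  proof (induction rule: vs2.span_induct_alt)
    case base
    have "f (s1 0 0) = s2 0 (f 0)" using sc vs1.subspace_0[OF V] by blast
    then show ?case using vs1.span_zero by (metis vs1.scale_zero_right vs2.scale_zero_left)
  next
    case (step c x y)
    then obtain z w where zw: "z \<in> A" "f z = x" "w \<in> vs1.span A" "f w = y" by blast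
    have wV: "w \<in> V" using zw A vs1.span_minimal[OF A(1) V] by blast
    have zV: "z \<in> V" using zw A by blast
    have "f (s1 c z + w) = s2 c x + y"
      using add[OF vs1.subspace_scale[OF V zV] wV] sc[OF zV] zw by simp
    moreover have "s1 c z + w \<in> vs1.span A"
      using zw by (simp add: vs1.span_add vs1.span_base vs1.span_scale)
    ultimately show ?case by blast
  qed
  have "V \<subseteq> vs1.span (A \<union> B)"
  proof
    fix v assume v: "v \<in> V"
    then obtain w where w: "w \<in> vs1.span A" "f w = f v" using fA C A by blast
    have wV: "w \<in> V" using w A vs1.span_minimal[OF A(1) V] by blast
    have vw: "v - w \<in> V" using v wV vs1.subspace_diff[OF V] by blast
    have "f (v - w) + f w = f (v - w + w)" using add[OF vw wV] by simp
    then have "f (v - w) = 0" using w by simp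
    then have "v - w \<in> vs1.span B" using B vw by blast
    then have "(v - w) + w \<in> vs1.span (A \<union> B)"
      using w by (meson Un_upper1 Un_upper2 subsetD vs1.span_add vs1.span_mono)
    then show "v \<in> vs1.span (A \<union> B)" by simp
  qed
  moreover have "card (A \<union> B) \<le> a + b"
    using A B C card_Un_le[of A B] by linarith
  ultimately show ?thesis using A B vs1.dim_at_mostI by blast
qed

lemma dim_at_most_image:
  assumes "Vector_Spaces.linear s1 s2 f" "vs1.dim_at_most S k"
  shows "vs2.dim_at_most (f ` S) k"
proof -
  obtain B where B: "finite B" "card B \<le> k" "S \<subseteq> vs1.span B"
    using assms by (auto simp: vs1.dim_at_most_def)
  have "f ` S \<subseteq> vs2.span (f ` B)" using B(3) linear_span_image[OF assms(1), of B] by auto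
  moreover have "card (f ` B) \<le> k" using B(2) card_image_le[OF B(1), of f] by linarith
  ultimately show ?thesis using B(1) vs2.dim_at_mostI[of "f ` B"] by simp
qed

end

section \<open>Trivial spectrum spaces of operators and the dimension bound\<close>

locale op_space = vspace scale
  for scale :: "'a::field \<Rightarrow> 'b::ab_group_add \<Rightarrow> 'b" (infixr "*s" 75)
begin

abbreviation opscale :: "'a \<Rightarrow> ('b \<Rightarrow> 'b) \<Rightarrow> 'b \<Rightarrow> 'b" where
  "opscale c M \<equiv> (\<lambda>v. c *s M v)"

sublocale op: vspace opscale
  by unfold_locales (simp_all add: fun_eq_iff scale_right_distrib scale_left_distrib)

sublocale fld: vspace "(*) :: 'a \<Rightarrow> 'a \<Rightarrow> 'a"
  by unfold_locales (simp_all add: algebra_simps)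

declare fld.scale_scale [simp del] \<comment> \<open>loops with \<open>mult.assoc\<close>\<close>

sublocale ov: vspace_pair opscale scale ..
sublocale oo: vspace_pair opscale opscale ..
sublocale ofl: vspace_pair opscale "(*) :: 'a \<Rightarrow> 'a \<Rightarrow> 'a" ..
sublocale vv: vspace_pair scale scale ..

abbreviation lin :: "('b \<Rightarrow> 'b) \<Rightarrow> bool" where
  "lin M \<equiv> Vector_Spaces.linear scale scale M"

abbreviation functional :: "('b \<Rightarrow> 'a) \<Rightarrow> bool" where
  "functional f \<equiv> Vector_Spaces.linear scale (*) f"

lemma lin_iff: "lin M \<longleftrightarrow> (\<forall>u v. M (u + v) = M u + M v) \<and> (\<forall>c v. M (c *s v) = c *s M v)"
  using vector_space_axioms by (auto simp: Vector_Spaces.linear_iff)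

lemma functional_iff:
  "functional f \<longleftrightarrow> (\<forall>u v. f (u + v) = f u + f v) \<and> (\<forall>c v. f (c *s v) = c * f v)"
  using vector_space_axioms fld.vector_space_axioms by (auto simp: Vector_Spaces.linear_iff)

lemma lin_add: "lin M \<Longrightarrow> M (u + v) = M u + M v"
  and lin_scale: "lin M \<Longrightarrow> M (c *s v) = c *s M v"
  and functional_add: "functional f \<Longrightarrow> f (u + v) = f u + f v"
  and functional_scale: "functional f \<Longrightarrow> f (c *s v) = c * f v"
  by (auto simp: lin_iff functional_iff)

lemma lin_zero: "lin M \<Longrightarrow> M 0 = 0"
  using lin_scale[of M 0 0] by simp

lemma functional_zero: "functional f \<Longrightarrow> f 0 = 0"
  using functional_scale[of f 0 0] by simp

lemma lin_diff: "lin M \<Longrightarrow> M (u - v) = M u - M v"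
  using lin_add[of M "u - v" v] by (simp add: algebra_simps)

lemma functional_diff: "functional f \<Longrightarrow> f (u - v) = f u - f v"
  using functional_add[of f "u - v" v] by (simp add: algebra_simps)

lemmas lin_simps = lin_add lin_scale lin_zero lin_diff
lemmas functional_simps = functional_add functional_scale functional_zero functional_diff

lemma lin_sum: "lin M \<Longrightarrow> M (sum f A) = (\<Sum>a\<in>A. M (f a))"
  by (induction A rule: infinite_finite_induct) (auto simp: lin_zero lin_add)

lemma lin_eq_0_span: "lin M \<Longrightarrow> v \<in> span B \<Longrightarrow> (\<And>b. b \<in> B \<Longrightarrow> M b = 0) \<Longrightarrow> M v = 0"
  using vv.linear_eq_0_on_span by blast

text \<open>Operators are total functions on the whole type. The fourth conjunct makes each of them
  determined by its restriction to \<open>U\<close>, so that counting functions is the same as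
  counting operators on \<open>U\<close>.\<close>

definition trivial_spectrum_on :: "'b set \<Rightarrow> ('b \<Rightarrow> 'b) set \<Rightarrow> bool" where
  "trivial_spectrum_on U V \<longleftrightarrow> op.subspace V \<and> (\<forall>M\<in>V. lin M) \<and> (\<forall>M\<in>V. \<forall>u\<in>U. M u \<in> U) \<and>
     (\<forall>M\<in>V. (\<forall>u\<in>U. M u = 0) \<longrightarrow> M = 0) \<and>
     (\<forall>M\<in>V. \<forall>u\<in>U. \<forall>c. M u = c *s u \<longrightarrow> u \<noteq> 0 \<longrightarrow> c = 0)"

text \<open>This condition makes passage to the quotient by \<open>x\<close> injective on the
  operators of \<open>V\<close> that kill \<open>x\<close>.\<close>

definition adapted :: "'b set \<Rightarrow> ('b \<Rightarrow> 'b) set \<Rightarrow> 'b \<Rightarrow> bool" where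
  "adapted U V x \<longleftrightarrow> (\<forall>M\<in>V. (\<forall>u\<in>U. \<exists>a. M u = a *s x) \<longrightarrow> M = 0)"

lemma trivial_spectrum_onD:
  assumes "trivial_spectrum_on U V"
  shows "op.subspace V" "M \<in> V \<Longrightarrow> lin M" "M \<in> V \<Longrightarrow> u \<in> U \<Longrightarrow> M u \<in> U"
    "M \<in> V \<Longrightarrow> (\<And>u. u \<in> U \<Longrightarrow> M u = 0) \<Longrightarrow> M = 0"
    "M \<in> V \<Longrightarrow> u \<in> U \<Longrightarrow> M u = c *s u \<Longrightarrow> u \<noteq> 0 \<Longrightarrow> c = 0"
  using assms unfolding trivial_spectrum_on_def by blast+

text \<open>Take a closed nonempty set of least cardinality. Deleting an element d destroys
  closedness at some b, whose only successor is then d. The map from d to b is injective on a finite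
  set, hence bijective, and \<open>s\<close> is its inverse.\<close>

lemma minimal_closed_subset:
  assumes "finite B" "B \<noteq> {}" and step: "\<And>b. b \<in> B \<Longrightarrow> \<exists>c\<in>B. R b c"
  obtains C s where "C \<subseteq> B" "C \<noteq> {}" "\<And>b. b \<in> C \<Longrightarrow> s b \<in> C"
    "\<And>b c. b \<in> C \<Longrightarrow> c \<in> C \<Longrightarrow> R b c \<longleftrightarrow> c = s b"
proof -
  let ?P = "\<lambda>C. C \<subseteq> B \<and> C \<noteq> {} \<and> (\<forall>b\<in>C. \<exists>c\<in>C. R b c)"
  have "?P B" using assms by blast
  then obtain C where C: "?P C" and min: "\<And>D. ?P D \<Longrightarrow> card C \<le> card D"
    using ex_has_least_nat[of ?P B card] by auto
  have finC: "finite C" using C assms(1) finite_subset by blast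
  have pre: "\<exists>b\<in>C. \<forall>c\<in>C. R b c \<longleftrightarrow> c = d" if d: "d \<in> C" for d
  proof (cases "C = {d}")
    case True
    then show ?thesis using C by blast
  next
    case False
    have "card (C - {d}) < card C" using card_Diff1_less[OF finC d] .
    then have "\<not> ?P (C - {d})" using min[of "C - {d}"] by linarith
    then obtain b where b: "b \<in> C - {d}" "\<forall>c\<in>C - {d}. \<not> R b c" using C False d by blast
    then show ?thesis using C by (metis Diff_iff insertCI singletonD)
  qed
  then obtain p where p: "\<And>d. d \<in> C \<Longrightarrow> p d \<in> C"
      "\<And>d c. d \<in> C \<Longrightarrow> c \<in> C \<Longrightarrow> R (p d) c \<longleftrightarrow> c = d"
    by metis
  have inj: "inj_on p C" using p by (metis inj_onI)
  then have surj: "p ` C = C" using finC p by (simp add: endo_inj_surj image_subsetI)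
  show ?thesis
  proof (rule that[of C "the_inv_into C p"])
    show "C \<subseteq> B" "C \<noteq> {}" using C by auto
    show "the_inv_into C p b \<in> C" if "b \<in> C" for b
    proof -
      have "b \<in> p ` C" unfolding surj by (rule that)
      then obtain d where d: "d \<in> C" "b = p d" by (elim imageE)
      show ?thesis unfolding d(2) the_inv_into_f_f[OF inj d(1)] by (rule d(1))
    qed
    show "R b c \<longleftrightarrow> c = the_inv_into C p b" if "b \<in> C" "c \<in> C" for b c
    proof -
      have "b \<in> p ` C" unfolding surj by (rule that(1))
      then obtain d where d: "d \<in> C" "b = p d" by (elim imageE)
      have "the_inv_into C p b = d" unfolding d(2) by (rule the_inv_into_f_f[OF inj d(1)])
      then show ?thesis using p(2)[OF d(1) that(2)] d(2) by simp
    qed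
  qed
qed

text \<open>Rank-one operators \<open>N b\<close> with image spanned by \<open>b\<close>, one for each \<open>b\<close> in a basis, combine
  to an operator fixing the sum of the basis vectors in a minimal cycle.\<close>

lemma exists_adapted:
  assumes V: "trivial_spectrum_on (span B) V" and B: "finite B" "independent B" "B \<noteq> {}"
  shows "\<exists>b\<in>B. adapted (span B) V b"
proof (rule ccontr)
  assume "\<not> ?thesis"
  then have "\<exists>M. M \<in> V \<and> M \<noteq> 0 \<and> (\<forall>u\<in>span B. \<exists>a. M u = a *s b)" if "b \<in> B" for b
    using that unfolding adapted_def by blast
  then obtain N where N: "\<And>b. b \<in> B \<Longrightarrow> N b \<in> V" "\<And>b. b \<in> B \<Longrightarrow> N b \<noteq> 0"
      "\<And>b u. b \<in> B \<Longrightarrow> u \<in> span B \<Longrightarrow> \<exists>a. N b u = a *s b"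
    by metis
  then obtain y where y: "\<And>b u. b \<in> B \<Longrightarrow> u \<in> span B \<Longrightarrow> N b u = y b u *s b"
    by metis
  have ex: "\<exists>c\<in>B. N b c \<noteq> 0" if "b \<in> B" for b
  proof (rule ccontr)
    assume "\<not> ?thesis"
    then have "N b u = 0" if "u \<in> span B" for u
      using lin_eq_0_span[OF trivial_spectrum_onD(2)[OF V N(1)[OF \<open>b \<in> B\<close>]] that] by blast
    then show False using trivial_spectrum_onD(4)[OF V N(1)[OF that]] N(2)[OF that] by blast
  qed
  obtain C s where C: "C \<subseteq> B" "C \<noteq> {}" "\<And>b. b \<in> C \<Longrightarrow> s b \<in> C"
      and s: "\<And>b c. b \<in> C \<Longrightarrow> c \<in> C \<Longrightarrow> N b c \<noteq> 0 \<longleftrightarrow> c = s b"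
    by (rule minimal_closed_subset[OF B(1,3), of "\<lambda>b c. N b c \<noteq> 0"]) (use ex in blast)+
  have finC: "finite C" using C B finite_subset by blast
  \<comment> \<open>Among the members of \<open>C\<close> only \<open>s b\<close> survives under
    \<open>N b\<close>; the scaling makes the term for \<open>b\<close> send the sum of
    \<open>C\<close> exactly to \<open>b\<close>, so \<open>M\<close> has eigenvalue 1.\<close>
  define M where "M = (\<Sum>b\<in>C. opscale (inverse (y b (s b))) (N b))"
  have MV: "M \<in> V" unfolding M_def
    by (rule op.subspace_sum[OF trivial_spectrum_onD(1)[OF V] op.subspace_scale[OF trivial_spectrum_onD(1)[OF V] N(1)]])
      (use C(1) in blast)
  have M_eq: "M v = (\<Sum>b\<in>C. inverse (y b (s b)) *s N b v)" for v
    unfolding M_def using finC by (induction C rule: finite_induct) auto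
  have Nb: "inverse (y b (s b)) *s N b (\<Sum>C) = b" if b: "b \<in> C" for b
  proof -
    have sb: "s b \<in> span B" by (rule span_base) (use C(1) C(3)[OF b] in blast)
    have bB: "b \<in> B" using b C(1) by blast
    have "N b (\<Sum>C) = (\<Sum>c\<in>C. N b c)"
      using lin_sum[OF trivial_spectrum_onD(2)[OF V N(1)]] b C by blast
    also have "\<dots> = (\<Sum>c\<in>C. if c = s b then N b (s b) else 0)"
      using s[OF b] by (intro sum.cong) auto
    also have "\<dots> = y b (s b) *s b"
      using finC C(3)[OF b] y[OF bB sb] by simp
    finally have *: "N b (\<Sum>C) = y b (s b) *s b" .
    have "N b (s b) \<noteq> 0" using s[OF b C(3)[OF b]] by blast
    then have "y b (s b) \<noteq> 0"
      using y[OF bB sb] by auto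
    then show ?thesis using * by simp
  qed
  have "M (\<Sum>C) = 1 *s \<Sum>C" using Nb by (simp add: M_eq)
  moreover have "\<Sum>C \<in> span B" using C by (meson span_base span_sum subset_iff)
  moreover have "\<Sum>C \<noteq> 0"
  proof
    assume "\<Sum>C = 0"
    then have "(\<Sum>b\<in>C. (\<lambda>_. 1) b *s b) = 0" by simp
    moreover obtain b where "b \<in> C" using C(2) by blast
    ultimately have "(1::'a) = 0"
      using independentD[OF B(2) finC C(1), of "\<lambda>_. 1" b] by blast
    then show False by simp
  qed
  ultimately show False using trivial_spectrum_onD(5)[OF V MV, of "\<Sum>C" 1] by simp
qed

section \<open>Evaluation at a vector, its kernel, and compression along that vector\<close>

lemma evaluation_subspace:
  assumes "op.subspace W" shows "subspace ((\<lambda>M. M v) ` W)"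
proof (rule subspaceI)
  show "0 \<in> (\<lambda>M. M v) ` W" using op.subspace_0[OF assms] by (auto intro!: image_eqI[of _ _ 0])
  show "x + y \<in> (\<lambda>M. M v) ` W" if "x \<in> (\<lambda>M. M v) ` W" "y \<in> (\<lambda>M. M v) ` W" for x y
    using that op.subspace_add[OF assms] by (fastforce intro!: image_eqI[of _ _ "_ + _"])
  show "c *s x \<in> (\<lambda>M. M v) ` W" if "x \<in> (\<lambda>M. M v) ` W" for c x
    using that op.subspace_scale[OF assms] by (fastforce intro!: image_eqI[of _ _ "opscale _ _"])
qed

lemma annihilator_subspace:
  assumes "op.subspace W" shows "op.subspace {M \<in> W. M x = 0}"
  using assms unfolding op.subspace_def by auto

text \<open>An eigenvector of the compression lifts: if M g = c g + \<phi>(M g) x with c nonzero,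
  then g + (\<phi>(M g) / c) x is an eigenvector of M for the same c, because M x = 0. If the
  compression of M vanishes, M maps \<open>U\<close> into the line of \<open>x\<close>, and
  adaptedness gives M = 0.\<close>

lemma compress_trivial_spectrum:
  assumes V: "trivial_spectrum_on U V" and x: "x \<in> U" "x \<noteq> 0" "adapted U V x"
    and \<phi>: "functional \<phi>" "\<phi> x = 1" and G: "G \<subseteq> U" "\<And>u. u \<in> U \<Longrightarrow> u - \<phi> u *s x \<in> G"
    and U: "subspace U"
  defines "\<pi> \<equiv> (\<lambda>v. v - \<phi> v *s x)"
  shows "trivial_spectrum_on G ((\<lambda>M. \<pi> \<circ> M) ` {M \<in> V. M x = 0})"
    and "\<And>M. M \<in> V \<Longrightarrow> M x = 0 \<Longrightarrow> \<pi> \<circ> M = 0 \<Longrightarrow> M = 0"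
proof -
  let ?W = "{M \<in> V. M x = 0}"
  have W: "op.subspace ?W" using annihilator_subspace trivial_spectrum_onD(1)[OF V] .
  have \<pi>: "lin \<pi>" unfolding \<pi>_def lin_iff
    by (auto simp: functional_simps[OF \<phi>(1)] algebra_simps)
  have ker: "M = 0" if M: "M \<in> ?W" "\<And>g. g \<in> G \<Longrightarrow> \<pi> (M g) = 0" for M
  proof -
    have linM: "lin M" using trivial_spectrum_onD(2)[OF V] M by blast
    have "\<exists>a. M u = a *s x" if u: "u \<in> U" for u
    proof -
      have "M (u - \<phi> u *s x) = M u" using M(1) by (simp add: lin_simps[OF linM])
      then have "\<pi> (M u) = 0" using M(2)[OF G(2)[OF u]] by simp
      then show ?thesis unfolding \<pi>_def by (metis eq_iff_diff_eq_0)
    qed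
    then show ?thesis using x(3) M(1) unfolding adapted_def by blast
  qed
  then show "\<And>M. M \<in> V \<Longrightarrow> M x = 0 \<Longrightarrow> \<pi> \<circ> M = 0 \<Longrightarrow> M = 0"
    by (metis (mono_tags, lifting) comp_apply mem_Collect_eq zero_fun_apply)
  show "trivial_spectrum_on G ((\<lambda>M. \<pi> \<circ> M) ` ?W)"
    unfolding trivial_spectrum_on_def
  proof (intro conjI ballI impI allI)
    show "op.subspace ((\<lambda>M. \<pi> \<circ> M) ` ?W)"
    proof (rule op.subspaceI)
      show "0 \<in> (\<lambda>M. \<pi> \<circ> M) ` ?W"
        by (rule image_eqI[of _ _ 0]) (use op.subspace_0[OF W] lin_zero[OF \<pi>] in \<open>auto simp: fun_eq_iff\<close>)
    next
      fix A B assume "A \<in> (\<lambda>M. \<pi> \<circ> M) ` ?W" "B \<in> (\<lambda>M. \<pi> \<circ> M) ` ?W"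
      then obtain M N where MN: "M \<in> ?W" "N \<in> ?W" "A = \<pi> \<circ> M" "B = \<pi> \<circ> N" by blast
      show "A + B \<in> (\<lambda>M. \<pi> \<circ> M) ` ?W"
        by (rule image_eqI[OF _ op.subspace_add[OF W MN(1,2)]])
          (use MN lin_add[OF \<pi>] in \<open>auto simp: fun_eq_iff\<close>)
    next
      fix c A assume "A \<in> (\<lambda>M. \<pi> \<circ> M) ` ?W"
      then obtain M where M: "M \<in> ?W" "A = \<pi> \<circ> M" by blast
      show "opscale c A \<in> (\<lambda>M. \<pi> \<circ> M) ` ?W"
        by (rule image_eqI[OF _ op.subspace_scale[OF W M(1)]])
          (use M lin_scale[OF \<pi>] in \<open>auto simp: fun_eq_iff\<close>)
    qed
  next
    fix A assume "A \<in> (\<lambda>M. \<pi> \<circ> M) ` ?W"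
    then obtain M where M: "M \<in> ?W" "A = \<pi> \<circ> M" by blast
    then have linM: "lin M" using trivial_spectrum_onD(2)[OF V] by blast
    show "lin A" using M(2) linM \<pi> by (auto simp: lin_iff)
    show "A g \<in> G" if "g \<in> G" for g
      using that M G trivial_spectrum_onD(3)[OF V] unfolding \<pi>_def by auto
    show "A = 0" if "\<forall>g\<in>G. A g = 0"
      using ker[OF M(1)] that M lin_zero[OF \<pi>] by (auto simp: fun_eq_iff)
    show "c = 0" if g: "g \<in> G" and "A g = c *s g" "g \<noteq> 0" for g c
    proof (rule ccontr)
      assume c: "c \<noteq> 0"
      let ?u = "g + (\<phi> (M g) / c) *s x"
      have eq: "M g = c *s g + \<phi> (M g) *s x"
        using that M by (simp add: \<pi>_def algebra_simps)
      have "M ?u = c *s ?u" using M eq c by (simp add: lin_simps[OF linM] scale_right_distrib)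
      moreover have "?u \<in> U" using g G x U by (meson subsetD subspace_add subspace_scale)
      moreover have "?u \<noteq> 0"
      proof
        assume "?u = 0"
        then have g': "g = - ((\<phi> (M g) / c) *s x)" by (simp add: eq_neg_iff_add_eq_0)
        then have "g = (- (\<phi> (M g) / c)) *s x" by (metis scale_minus_left)
        then have "M g = 0" using M by (metis (mono_tags, lifting) lin_scale[OF linM] mem_Collect_eq scale_zero_right)
        then have "A g = 0" using M lin_zero[OF \<pi>] by simp
        then show False using that c by simp
      qed
      ultimately show False using trivial_spectrum_onD(5)[OF V] M c by blast
    qed
  qed
qed

lemma compress_dim:
  assumes "trivial_spectrum_on U V" "functional \<phi>"
    and inj: "\<And>M. M \<in> V \<Longrightarrow> M x = 0 \<Longrightarrow> (\<lambda>v. v - \<phi> v *s x) \<circ> M = 0 \<Longrightarrow> M = 0"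
    and "op.dim_at_most ((\<lambda>M. (\<lambda>v. v - \<phi> v *s x) \<circ> M) ` {M \<in> V. M x = 0}) k"
  shows "op.dim_at_most {M \<in> V. M x = 0} k"
proof -
  let ?f = "\<lambda>M. (\<lambda>v. v - \<phi> v *s x) \<circ> M"
  let ?W = "{M \<in> V. M x = 0}"
  have "{M \<in> ?W. ?f M = 0} \<subseteq> {0}" using inj by blast
  then have "op.dim_at_most {M \<in> ?W. ?f M = 0} 0" by (simp add: op.dim_at_most_zero_iff)
  then have "op.dim_at_most ?W (k + 0)"
    by (intro oo.rank_nullity_bound[of _ ?f])
      (use assms annihilator_subspace[OF trivial_spectrum_onD(1)[OF assms(1)]] in
        \<open>auto simp: fun_eq_iff functional_simps[OF assms(2)] algebra_simps\<close>)
  then show ?thesis by simp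
qed

lemma dim_sum_annihilator:
  assumes "op.subspace V" "dim_at_most ((\<lambda>M. M x) ` V) a" "op.dim_at_most {M \<in> V. M x = 0} b"
  shows "op.dim_at_most V (a + b)"
  by (rule ov.rank_nullity_bound[of V "\<lambda>M. M x"]) (use assms in auto)

text \<open>If \<open>x\<close> were M x, then 1 would be an eigenvalue of M; hence V x is a proper
  subspace of \<open>U\<close>.\<close>

lemma evaluation_proper:
  assumes V: "trivial_spectrum_on U V" and x: "x \<in> U" "x \<noteq> 0" and "dim_at_most U (Suc m)"
  shows "dim_at_most ((\<lambda>M. M x) ` V) m" "x \<notin> (\<lambda>M. M x) ` V"
proof -
  show *: "x \<notin> (\<lambda>M. M x) ` V" using trivial_spectrum_onD(5)[OF V _ x(1), of _ 1] x(2) by force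
  have "(\<lambda>M. M x) ` V \<subset> U" using * x(1) trivial_spectrum_onD(3)[OF V] by blast
  then show "dim_at_most ((\<lambda>M. M x) ` V) m"
    using dim_at_most_psubset[OF evaluation_subspace[OF trivial_spectrum_onD(1)[OF V]] _ assms(4)] by blast
qed

section \<open>The dimension bound and its equality case\<close>

definition maxdim :: "nat \<Rightarrow> nat" where "maxdim m = m * (m - 1) div 2"

lemma maxdim_Suc: "maxdim (Suc m) = m + maxdim m"
proof (cases m)
  case (Suc k)
  have "m * (m - 1) + 2 * m = Suc m * m" using Suc by (simp add: algebra_simps)
  then show ?thesis unfolding maxdim_def by (metis diff_Suc_1 div_mult_self2 add.commute zero_neq_numeral)
qed (simp add: maxdim_def)

lemma compress_basis:
  assumes V: "trivial_spectrum_on (span B) V" and B: "independent B" "x \<in> B" and x: "adapted (span B) V x"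
  shows "\<exists>V'. trivial_spectrum_on (span (B - {x})) V' \<and>
    (\<forall>k. op.dim_at_most V' k \<longrightarrow> op.dim_at_most {M \<in> V. M x = 0} k)"
proof -
  let ?B = "B - {x}"
  have xs: "x \<notin> span ?B" using B dependent_def by blast
  then obtain \<phi> where \<phi>: "functional \<phi>" "\<phi> x = 1" "\<And>s. s \<in> span ?B \<Longrightarrow> \<phi> s = 0"
    using exists_complement_functional[OF subspace_span] by blast
  have x0: "x \<in> span B" "x \<noteq> 0" using B xs span_base span_zero by auto
  have G: "span ?B \<subseteq> span B" by (simp add: span_mono)
  have dec: "u - \<phi> u *s x \<in> span ?B" if "u \<in> span B" for u
  proof -
    have "u \<in> span (insert x ?B)" using that B by (simp add: insert_absorb)
    then obtain a where a: "u - a *s x \<in> span ?B" unfolding span_insert by blast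
    then have "\<phi> u = a" using \<phi>(2) \<phi>(3)[OF a] by (simp add: functional_simps[OF \<phi>(1)])
    then show ?thesis using a by simp
  qed
  note c = compress_trivial_spectrum[OF V x0 x \<phi>(1,2) G dec subspace_span]
  show ?thesis using c(1) compress_dim[OF V \<phi>(1) c(2)] by blast
qed

theorem trivial_spectrum_dim:
  assumes "finite B" "independent B" "trivial_spectrum_on (span B) V"
  shows "op.dim_at_most V (maxdim (card B))"
  using assms
proof (induction "card B" arbitrary: B V)
  case 0
  then have "B = {}" by simp
  then have "V \<subseteq> {0}" using trivial_spectrum_onD(4)[OF 0(4)] lin_zero[OF trivial_spectrum_onD(2)[OF 0(4)]] by auto
  then show ?case using op.dim_at_most_zero_iff op.dim_at_most_mono by blast
next
  case (Suc m)
  have "B \<noteq> {}" using Suc by auto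
  then obtain x where x: "x \<in> B" "adapted (span B) V x"
    using exists_adapted Suc by blast
  obtain V' where V': "trivial_spectrum_on (span (B - {x})) V'"
    "\<And>k. op.dim_at_most V' k \<Longrightarrow> op.dim_at_most {M \<in> V. M x = 0} k"
    using compress_basis[OF Suc(5,4) x] by blast
  have indB: "independent (B - {x})" using Suc(4) independent_mono by blast
  have cardB: "m = card (B - {x})" using Suc x by simp
  have "op.dim_at_most {M \<in> V. M x = 0} (maxdim m)"
    using V'(2) Suc(1)[OF cardB _ indB V'(1)] Suc(3) cardB by simp
  moreover have "dim_at_most (span B) (Suc m)"
    using Suc by (intro dim_at_mostI[of B]) auto
  then have "dim_at_most ((\<lambda>M. M x) ` V) m"
    using evaluation_proper[OF Suc(5)] x(1) Suc(4) span_base dependent_zero by metis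
  ultimately have "op.dim_at_most V (m + maxdim m)"
    using dim_sum_annihilator[OF trivial_spectrum_onD(1)[OF Suc(5)]] by blast
  then show ?case using Suc(2) maxdim_Suc by metis
qed

lemma maxdim_mono: "i \<le> j \<Longrightarrow> maxdim i \<le> maxdim j"
  by (induction rule: dec_induct) (auto simp: maxdim_Suc)

lemma trivial_spectrum_dim_subspace:
  assumes "subspace U" "dim_at_most U m" "trivial_spectrum_on U V"
  shows "op.dim_at_most V (maxdim m)"
proof -
  obtain B where B: "finite B" "card B \<le> m" "independent B" "span B = U"
    by (rule dim_at_most_basis[OF assms(1,2)])
  then show ?thesis
    using trivial_spectrum_dim[of B V] assms(3) op.dim_at_most_mono maxdim_mono by simp
qed

text \<open>The dimension of \<open>V\<close> splits into that of V x, at most \<open>m\<close>, and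
  that of the annihilator of \<open>x\<close>, at most \<open>maxdim m\<close>. These bounds add up
  to \<open>maxdim (Suc m)\<close>, so extremality of \<open>V\<close> forces both to be
  attained.\<close>

lemma maximal_annihilator:
  assumes V: "trivial_spectrum_on U V" and U: "subspace U" "dim_at_most U (Suc m)"
    and x: "x \<in> U" "x \<noteq> 0" "adapted U V x"
    and max: "\<And>k. op.dim_at_most V k \<Longrightarrow> maxdim (Suc m) \<le> k"
  shows "\<And>k. dim_at_most ((\<lambda>M. M x) ` V) k \<Longrightarrow> m \<le> k"
    and "\<And>k. op.dim_at_most {M \<in> V. M x = 0} k \<Longrightarrow> maxdim m \<le> k"
proof -
  have "{x} \<subseteq> U" "independent {x}" using x by auto
  then obtain B where B: "{x} \<subseteq> B" "B \<subseteq> U" "independent B" "U \<subseteq> span B"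
    by (rule maximal_independent_subset_extend)
  have sB: "span B = U" using B span_minimal[OF B(2) U(1)] by blast
  have fB: "finite B" "card B \<le> Suc m" using independent_card_le[OF B(3,2) U(2)] by auto
  have xB: "x \<in> B" using B(1) by auto
  obtain V' where V': "trivial_spectrum_on (span (B - {x})) V'"
    "\<And>k. op.dim_at_most V' k \<Longrightarrow> op.dim_at_most {M \<in> V. M x = 0} k"
    using compress_basis[OF V[folded sB] B(3) xB x(3)[folded sB]] by blast
  have "independent (B - {x})" using B(3) independent_mono by blast
  then have "op.dim_at_most V' (maxdim (card (B - {x})))"
    using trivial_spectrum_dim[OF _ _ V'(1)] fB by simp
  moreover have "card (B - {x}) \<le> m" using fB B(1) by auto
  ultimately have W: "op.dim_at_most {M \<in> V. M x = 0} (maxdim m)"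
    using V'(2) op.dim_at_most_mono maxdim_mono by blast
  show "m \<le> k" if "dim_at_most ((\<lambda>M. M x) ` V) k" for k
    using max[OF dim_sum_annihilator[OF trivial_spectrum_onD(1)[OF V] that W]] by (simp add: maxdim_Suc)
  show "maxdim m \<le> k" if "op.dim_at_most {M \<in> V. M x = 0} k" for k
    using max[OF dim_sum_annihilator[OF trivial_spectrum_onD(1)[OF V] evaluation_proper(1)[OF V x(1,2) U(2)] that]]
    by (simp add: maxdim_Suc)
qed

end

section \<open>Extremal spaces: the plane lemma\<close>

text \<open>The coefficients are the cross product of the rows p and q. If it vanishes, the rows are
  proportional, and a relation annihilating a nonzero row annihilates the other one too.\<close>

lemma three_vectors_dependent:
  fixes p1 p2 p3 q1 q2 q3 :: "'a::field"
  shows "\<exists>a b c. \<not> (a = 0 \<and> b = 0 \<and> c = 0) \<and>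
    a * p1 + b * p2 + c * p3 = 0 \<and> a * q1 + b * q2 + c * q3 = 0"
proof (cases "p2 * q3 - p3 * q2 = 0 \<and> p3 * q1 - p1 * q3 = 0 \<and> p1 * q2 - p2 * q1 = 0")
  case False
  show ?thesis
    by (rule exI[of _ "p2 * q3 - p3 * q2"], rule exI[of _ "p3 * q1 - p1 * q3"],
        rule exI[of _ "p1 * q2 - p2 * q1"])
      (use False in \<open>auto simp: algebra_simps\<close>)
next
  case True
  consider "p1 = 0" "q1 = 0" | "p1 \<noteq> 0" | "q1 \<noteq> 0" by blast
  then show ?thesis
  proof cases
    case 1
    then show ?thesis by (intro exI[of _ 1] exI[of _ 0]) simp
  next
    case 2
    show ?thesis
      by (rule exI[of _ p2], rule exI[of _ "- p1"], rule exI[of _ 0])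
        (use 2 True in \<open>auto simp: algebra_simps\<close>)
  next
    case 3
    show ?thesis
      by (rule exI[of _ q2], rule exI[of _ "- q1"], rule exI[of _ 0])
        (use 3 True in \<open>auto simp: algebra_simps\<close>)
  qed
qed

context op_space
begin

text \<open>For \<open>h\<close> in \<open>H\<close> the points g + t h never lie in
  \<open>H\<close>, so t p(g, h) + t^2 q(h) = 0 for all t. Comparing t = 1 with t = s leaves s (s -
  1) q(h) = 0.\<close>

lemma quadratic_vanish:
  fixes q :: "'b \<Rightarrow> 'a" and s :: 'a
  assumes s: "s \<noteq> 0" "s \<noteq> 1" and G: "subspace G" and H: "subspace H" and g: "g \<in> G" "g \<notin> H"
    and q: "\<And>a b t. a \<in> G \<Longrightarrow> b \<in> G \<Longrightarrow> q (a + t *s b) = q a + t * p a b + t * t * q b"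
    and van: "\<And>h. h \<in> G \<Longrightarrow> h \<notin> H \<Longrightarrow> q h = 0" and h: "h \<in> G"
  shows "q h = 0"
proof (cases "h \<in> H")
  case False
  then show ?thesis using van h by blast
next
  case True
  have "q (g + t *s h) = 0" for t
  proof -
    have "g + t *s h \<in> G" using g h G subspace_add subspace_scale by blast
    moreover have "g + t *s h \<notin> H"
    proof
      assume "g + t *s h \<in> H"
      then have "(g + t *s h) - t *s h \<in> H" using True H subspace_diff subspace_scale by blast
      then show False using g by simp
    qed
    ultimately show ?thesis using van by blast
  qed
  then have *: "t * p g h + t * t * q h = 0" for t
    using q[OF g(1) h, of t] van[OF g] by simp
  have "p g h = - q h" using *[of 1] by (simp add: eq_neg_iff_add_eq_0)
  then have "(s * (s - 1)) * q h = s * p g h + s * s * q h" by (simp add: right_diff_distrib left_diff_distrib)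
  also have "\<dots> = 0" by (rule *)
  finally have "(s * (s - 1)) * q h = 0" .
  then show ?thesis using s by simp
qed

text \<open>If the vectors that are not adapted spanned \<open>G\<close>, they would contain a basis
  of it, against \<open>exists_adapted\<close>; \<open>H\<close> is their span. The nonzero
  \<open>g\<close> keeps that basis nonempty.\<close>

lemma nonadapted_in_hyperplane:
  assumes G: "subspace G" "dim_at_most G m" and V: "trivial_spectrum_on G V" and g: "g \<in> G" "g \<noteq> 0"
  shows "\<exists>H. subspace H \<and> \<not> G \<subseteq> H \<and> (\<forall>h\<in>G. h \<notin> H \<longrightarrow> adapted G V h)"
proof -
  let ?A = "{h \<in> G. \<not> adapted G V h}"
  have "\<not> G \<subseteq> span ?A"
  proof
    assume GA: "G \<subseteq> span ?A"
    obtain B where B: "B \<subseteq> ?A" "independent B" "?A \<subseteq> span B"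
      using maximal_independent_subset by blast
    have BG: "B \<subseteq> G" using B(1) by auto
    have "span ?A \<subseteq> span B" using B(3) span_minimal subspace_span by auto
    then have sB: "span B = G" using GA span_minimal[OF BG G(1)] by auto
    have "finite B" using independent_card_le[OF B(2) BG G(2)] by simp
    moreover have "B \<noteq> {}" using sB g by auto
    ultimately show False using exists_adapted[of B V] V sB B(1,2) by auto
  qed
  then show ?thesis
    by (intro exI[of _ "span ?A"]) (use span_base[of _ ?A] in blast)
qed

end

text \<open>This records what equality provides: V x is a hyperplane of \<open>U\<close> missing
  \<open>x\<close>, equal to the kernel of \<open>\<phi>\<close> on \<open>U\<close>, and the
  operators killing \<open>x\<close> again reach the full bound \<open>maxdim m\<close>. The element
  \<open>s\<close> is the third scalar.\<close>

locale maximal_trivial_spectrum = op_space scale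
  for scale :: "'a::field \<Rightarrow> 'b::ab_group_add \<Rightarrow> 'b" (infixr "*s" 75) +
  fixes U :: "'b set" and V :: "('b \<Rightarrow> 'b) set" and m :: nat
    and x :: 'b and \<phi> :: "'b \<Rightarrow> 'a" and s :: 'a
  assumes U: "subspace U" "dim_at_most U (Suc m)" "\<And>k. dim_at_most U k \<Longrightarrow> Suc m \<le> k"
    and V: "trivial_spectrum_on U V"
    and x: "x \<in> U" "adapted U V x"
    and \<phi>: "functional \<phi>" "\<phi> x = 1" "\<And>M. M \<in> V \<Longrightarrow> \<phi> (M x) = 0"
    and onto: "\<And>u. u \<in> U \<Longrightarrow> \<phi> u = 0 \<Longrightarrow> \<exists>M\<in>V. M x = u"
    and W_max: "\<And>k. op.dim_at_most {M \<in> V. M x = 0} k \<Longrightarrow> maxdim m \<le> k"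
    and s: "s \<noteq> 0" "s \<noteq> 1"
begin

definition G :: "'b set" where "G = {u \<in> U. \<phi> u = 0}"

definition W :: "('b \<Rightarrow> 'b) set" where "W = {M \<in> V. M x = 0}"

definition \<pi> :: "'b \<Rightarrow> 'b" where "\<pi> v = v - \<phi> v *s x"

text \<open>That \<open>W\<close> itself maps \<open>G\<close> into \<open>G\<close> is established
  only in \<open>W_\<phi>\<close>; until then its compression stands in for it.\<close>

definition V' :: "('b \<Rightarrow> 'b) set" where "V' = (\<lambda>M. \<pi> \<circ> M) ` W"

lemmas \<phi>_simps = functional_simps[OF \<phi>(1)] \<phi>(2)

lemma x_nz: "x \<noteq> 0" using \<phi>_simps by auto

lemma V_lin: "M \<in> V \<Longrightarrow> lin M" using trivial_spectrum_onD(2)[OF V] .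

lemmas V_simps = lin_simps[OF V_lin]

lemma V_U: "M \<in> V \<Longrightarrow> u \<in> U \<Longrightarrow> M u \<in> U" using trivial_spectrum_onD(3)[OF V] .

lemma V_sub: "op.subspace V" using trivial_spectrum_onD(1)[OF V] .

lemma W_sub: "op.subspace W" unfolding W_def by (rule annihilator_subspace[OF V_sub])

lemma W_V: "N \<in> W \<Longrightarrow> N \<in> V" and W_x: "N \<in> W \<Longrightarrow> N x = 0" by (auto simp: W_def)

lemma G_sub: "subspace G"
  unfolding G_def using U(1) by (auto simp: subspace_def \<phi>_simps)

lemma G_U: "g \<in> G \<Longrightarrow> g \<in> U" and G_\<phi>: "g \<in> G \<Longrightarrow> \<phi> g = 0"
  by (auto simp: G_def)

lemma \<pi>_G: "u \<in> U \<Longrightarrow> \<pi> u \<in> G"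
  using U(1) x by (auto simp: G_def \<pi>_def \<phi>_simps intro: subspace_diff subspace_scale)

lemma \<pi>_lin: "lin \<pi>"
  by (auto simp: lin_iff \<pi>_def \<phi>_simps algebra_simps)

lemma \<pi>_id: "g \<in> G \<Longrightarrow> \<pi> g = g" by (simp add: \<pi>_def G_\<phi>)

lemma Mx_G: "M \<in> V \<Longrightarrow> M x \<in> G"
  using \<phi>(3) V_U x by (auto simp: G_def)

lemma onto_G: "c \<in> G \<Longrightarrow> \<exists>M\<in>V. M x = c"
  using onto by (auto simp: G_def)

lemma functional_killing_G:
  assumes "functional f" "\<And>g. g \<in> G \<Longrightarrow> f g = 0" "u \<in> U" shows "f u = f x * \<phi> u"
proof -
  have "f (\<pi> u) = 0" using assms \<pi>_G by blast
  then show ?thesis using assms by (simp add: \<pi>_def functional_simps[OF assms(1)])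
qed

lemma V'_trivial_spectrum: "trivial_spectrum_on G V'"
  and V'_inj: "\<And>M. M \<in> W \<Longrightarrow> \<pi> \<circ> M = 0 \<Longrightarrow> M = 0"
proof -
  have sub: "G \<subseteq> U" using G_U by auto
  have dec: "u - \<phi> u *s x \<in> G" if "u \<in> U" for u using \<pi>_G[OF that] by (simp add: \<pi>_def)
  note c = compress_trivial_spectrum[OF V x(1) x_nz x(2) \<phi>(1,2) sub dec U(1)]
  show "trivial_spectrum_on G V'" unfolding V'_def W_def \<pi>_def[abs_def] by (rule c(1))
  show "M = 0" if "M \<in> W" "\<pi> \<circ> M = 0" for M
    using c(2)[of M] that unfolding W_def \<pi>_def[abs_def] by simp
qed

lemma V'_max: "op.dim_at_most V' k \<Longrightarrow> maxdim m \<le> k"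
  using W_max compress_dim[OF V \<phi>(1), of x k] V'_inj
  unfolding V'_def W_def \<pi>_def[abs_def] by auto

lemma G_dim: "dim_at_most G m"
proof -
  have "x \<notin> G" using \<phi>(2) by (simp add: G_def)
  then have "G \<subset> U" using x(1) G_U by blast
  then show ?thesis using dim_at_most_psubset[OF G_sub _ U(2)] by blast
qed

lemma value_functional:
  assumes "w \<in> U" "w \<noteq> 0"
  obtains f where "functional f" "f w = 1" "\<And>M. M \<in> V \<Longrightarrow> f (M w) = 0"
proof -
  have "w \<notin> (\<lambda>M. M w) ` V" using evaluation_proper(2)[OF V assms U(2)] .
  then obtain f where "functional f" "f w = 1" "\<And>s. s \<in> (\<lambda>M. M w) ` V \<Longrightarrow> f s = 0"
    using exists_complement_functional[OF evaluation_subspace[OF V_sub]] by blast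
  then show ?thesis using that by blast
qed

text \<open>The functionals annihilating \<open>V h\<close>, \<open>V (x + h)\<close> and \<open>V (x + s h)\<close> all annihilate \<open>W h\<close>,
  whose codimension is at most two, so they are linearly dependent.  The existence of a fourth
  point on the line through \<open>x\<close> and \<open>h\<close> is where a third scalar \<open>s\<close> is needed.\<close>

lemma plane_functional:
  assumes h: "h \<in> G" "h \<noteq> 0" and Wh: "\<And>k. dim_at_most ((\<lambda>M. M h) ` W) k \<Longrightarrow> m \<le> Suc k"
  shows "\<exists>\<psi>. functional \<psi> \<and> (\<forall>M\<in>V. \<psi> (M h) = 0 \<and> \<psi> (M x) + \<phi> (M h) = 0)"
proof -
  have hU: "h \<in> U" using h G_U by blast
  have wU: "x + t *s h \<in> U" for t using hU x U(1) subspace_add subspace_scale by blast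
  have "\<phi> (x + t *s h) = 1" for t using h by (simp add: \<phi>_simps G_\<phi>)
  then have w0: "x + t *s h \<noteq> 0" for t using \<phi>_simps by (metis zero_neq_one)
  obtain f where f: "functional f" "f h = 1" "\<And>M. M \<in> V \<Longrightarrow> f (M h) = 0"
    using value_functional[OF hU h(2)] by blast
  obtain f1 where f1: "functional f1" "f1 (x + 1 *s h) = 1" "\<And>M. M \<in> V \<Longrightarrow> f1 (M (x + 1 *s h)) = 0"
    using value_functional[OF wU w0] by blast
  obtain fs where fs: "functional fs" "fs (x + s *s h) = 1" "\<And>M. M \<in> V \<Longrightarrow> fs (M (x + s *s h)) = 0"
    using value_functional[OF wU w0] by blast
  note fsimps = functional_simps[OF f(1)] functional_simps[OF f1(1)] functional_simps[OF fs(1)]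
  have f1V: "f1 (M x) = - f1 (M h)" if "M \<in> V" for M
    using f1(3)[OF that] by (simp add: V_simps[OF that] fsimps eq_neg_iff_add_eq_0)
  have fsV: "fs (M x) = - s * fs (M h)" if "M \<in> V" for M
    using fs(3)[OF that] by (simp add: V_simps[OF that] fsimps eq_neg_iff_add_eq_0)
  let ?Y = "(\<lambda>M. M h) ` W"
  have Y0: "f y = 0" "f1 y = 0" "fs y = 0" if y: "y \<in> ?Y" for y
  proof -
    obtain M where M: "M \<in> V" "M x = 0" "y = M h" using y W_V W_x by blast
    show "f y = 0" "f1 y = 0" "fs y = 0"
      using f(3)[OF M(1)] f1V[OF M(1)] fsV[OF M(1)] s unfolding M(2,3) by (simp_all add: fsimps)
  qed
  have YU: "?Y \<subseteq> U" using V_U W_V hU by blast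
  have mpos: "m \<noteq> 0"
  proof
    assume "m = 0"
    then have "G \<subseteq> {0}" using G_dim dim_at_most_zero_iff by simp
    then show False using h by auto
  qed
  then obtain k where mk: "m = Suc k" by (cases m) auto
  obtain u v where uv: "u \<in> U" "v \<in> U" "\<And>w. w \<in> U \<Longrightarrow> \<exists>a b. w - a *s u - b *s v \<in> ?Y"
    by (rule complement_codim_two[OF evaluation_subspace[OF W_sub] YU U(1), of k])
      (use U(2) mk Wh in auto)
  obtain c b d where cbd: "\<not> (c = 0 \<and> b = 0 \<and> d = 0)"
      "c * f u + b * f1 u + d * fs u = 0" "c * f v + b * f1 v + d * fs v = 0"
    using three_vectors_dependent[of "f u" "f1 u" "fs u" "f v" "f1 v" "fs v"] by metis
  have dep: "c * f w + b * f1 w + d * fs w = 0" if w: "w \<in> U" for w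
  proof -
    obtain p q where pq: "w - p *s u - q *s v \<in> ?Y" using uv(3)[OF w] by blast
    have eqs: "f w = p * f u + q * f v" "f1 w = p * f1 u + q * f1 v" "fs w = p * fs u + q * fs v"
      using Y0[OF pq] by (simp_all add: fsimps algebra_simps)
    have "c * f w + b * f1 w + d * fs w =
        p * (c * f u + b * f1 u + d * fs u) + q * (c * f v + b * f1 v + d * fs v)"
      by (simp only: eqs distrib_left distrib_right ac_simps)
    then show ?thesis using cbd by simp
  qed
  \<comment> \<open>The weight is chosen so that f1(M x) = - f1(M h) and fs(M x) = - s fs(M h) turn
    \<chi>(M x) into -(b f1 + d fs)(M h) = c f(M h) = 0. Thus \<chi> kills V x = \<open>G\<close>
    and is a multiple of \<open>\<phi>\<close> on \<open>U\<close>.\<close>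
  define \<delta> where "\<delta> = d / s"
  have d: "d = s * \<delta>" using s by (simp add: \<delta>_def)
  let ?\<chi> = "\<lambda>v. b * f1 v + \<delta> * fs v"
  have \<chi>: "functional ?\<chi>"
    by (simp only: functional_iff fsimps distrib_left distrib_right ac_simps) simp
  have \<chi>G: "?\<chi> g = 0" if g: "g \<in> G" for g
  proof -
    obtain M where M: "M \<in> V" "M x = g" using onto_G[OF g] by blast
    have "?\<chi> (M x) = - (b * f1 (M h) + d * fs (M h))"
      unfolding f1V[OF M(1)] fsV[OF M(1)] d by (simp add: mult.assoc mult.left_commute)
    also have "\<dots> = 0" using dep[OF V_U[OF M(1) hU]] f(3)[OF M(1)] by simp
    finally show ?thesis using M by simp
  qed
  define \<alpha> where "\<alpha> = ?\<chi> x"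
  have \<chi>\<phi>: "?\<chi> u = \<alpha> * \<phi> u" if "u \<in> U" for u
    unfolding \<alpha>_def by (rule functional_killing_G[OF \<chi> \<chi>G that])
  \<comment> \<open>The dependence relation after eliminating \<open>fs\<close> by means of \<chi> =
    \<alpha> \<phi>.\<close>
  have rel: "c * f u + (1 - s) * b * f1 u + s * \<alpha> * \<phi> u = 0" if "u \<in> U" for u
  proof -
    have "c * f u + (1 - s) * b * f1 u + s * \<alpha> * \<phi> u
        = (c * f u + b * f1 u + d * fs u) + s * (\<alpha> * \<phi> u - ?\<chi> u)"
      unfolding d by (simp add: algebra_simps)
    then show ?thesis using dep[OF that] \<chi>\<phi>[OF that] by simp
  qed
  show ?thesis
  proof (cases "\<alpha> = 0")
    case False
    have nz: "s * \<alpha> \<noteq> 0" using False s by simp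
    show ?thesis
    proof (rule exI[of _ "\<lambda>v. c / (s * \<alpha>) * f v"], intro conjI ballI)
      show "functional (\<lambda>v. c / (s * \<alpha>) * f v)"
        by (simp add: functional_iff fsimps distrib_left add_divide_distrib)
      fix M assume M: "M \<in> V"
      show "c / (s * \<alpha>) * f (M h) = 0" using f(3)[OF M] by simp
      have e: "c * f (M x) + (1 - s) * b * f1 (M x) + s * \<alpha> * \<phi> (M x) = 0"
        "c * f (M h) + (1 - s) * b * f1 (M h) + s * \<alpha> * \<phi> (M h) = 0"
        using rel V_U[OF M] x(1) hU by auto
      \<comment> \<open>In the sum of the relations at M x and at M h the two values of
        \<open>f1\<close> cancel.\<close>
      have "c * f (M x) + s * \<alpha> * \<phi> (M h) = 0"
        using arg_cong2[OF e, of "(+)"] f(3)[OF M] f1V[OF M] \<phi>(3)[OF M] by simp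
      then have "(c * f (M x) + s * \<alpha> * \<phi> (M h)) / (s * \<alpha>) = 0" by simp
      then show "c / (s * \<alpha>) * f (M x) + \<phi> (M h) = 0"
        using nz by (simp add: add_divide_distrib)
    qed
  next
    \<comment> \<open>Here \<open>fs\<close> is a multiple of \<open>f1\<close> on \<open>U\<close>,
      so it annihilates both V (x + h) and V (x + s h), hence V h and V x, because \<open>s\<close>
      differs from 1. It is then a nonzero multiple of \<open>\<phi>\<close>, so
      \<open>\<phi>\<close> kills V h and \<psi> = 0 serves.\<close>
    case True
    have "\<delta> \<noteq> 0"
    proof
      assume \<delta>: "\<delta> = 0"
      have "b = 0" using \<chi>\<phi>[OF wU[of 1]] True \<delta> f1(2) by simp
      moreover have "c = 0" using rel[OF hU] True \<open>b = 0\<close> f(2) by simp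
      ultimately show False using cbd(1) \<delta> d by simp
    qed
    then have fs_eq: "fs u = - (b / \<delta>) * f1 u" if "u \<in> U" for u
      using \<chi>\<phi>[OF that] True by (simp add: field_simps eq_neg_iff_add_eq_0)
    have fsM: "fs (M h) = 0 \<and> fs (M x) = 0" if M: "M \<in> V" for M
    proof -
      have "fs (M (x + 1 *s h)) = 0" using fs_eq[OF V_U[OF M wU[of 1]]] f1(3)[OF M] by simp
      then have "(1 - s) * fs (M h) = 0"
        using fsV[OF M] by (simp add: V_simps[OF M] fsimps algebra_simps)
      then show ?thesis using s fsV[OF M] by simp
    qed
    then have "fs g = 0" if "g \<in> G" for g using onto_G[OF that] by auto
    then have fs\<phi>: "fs u = fs x * \<phi> u" if "u \<in> U" for u
      using functional_killing_G[OF fs(1) _ that] by blast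
    have "fs x \<noteq> 0" using fs\<phi>[OF wU[of s]] fs(2) by auto
    then have "\<phi> (M h) = 0" if "M \<in> V" for M
      using fs\<phi>[OF V_U[OF that hU]] fsM[OF that] by simp
    then show ?thesis by (intro exI[of _ "\<lambda>_. 0"]) (simp add: functional_iff)
  qed
qed

end

section \<open>The alternating form on the hyperplane\<close>

context maximal_trivial_spectrum
begin

text \<open>The conclusion, with \<phi>(M x) = 0, says that \<phi> + t \<psi> annihilates V (x + t
  h) for every t: the annihilating functional depends linearly on the point. The codimension
  hypothesis of \<open>plane_functional\<close> holds because \<open>\<pi>\<close> maps W h onto V'
  h, which has dimension at least m - 1 by extremality of \<open>V'\<close>.\<close>

lemma adapted_plane_functional:
  assumes h: "h \<in> G" "h \<noteq> 0" "adapted G V' h"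
  shows "\<exists>\<psi>. functional \<psi> \<and> (\<forall>M\<in>V. \<psi> (M h) = 0 \<and> \<psi> (M x) + \<phi> (M h) = 0)"
proof (rule plane_functional[OF h(1,2)])
  fix k assume k: "dim_at_most ((\<lambda>M. M h) ` W) k"
  have "(\<lambda>M. M h) ` V' = \<pi> ` ((\<lambda>M. M h) ` W)" unfolding V'_def by (auto simp: image_image)
  then have V'k: "dim_at_most ((\<lambda>M. M h) ` V') k"
    using vv.dim_at_most_image[OF \<pi>_lin k] by simp
  show "m \<le> Suc k"
  proof (cases m)
    case (Suc j)
    have "j \<le> k"
      by (rule maximal_annihilator(1)[OF V'_trivial_spectrum G_sub _ h _ V'k])
        (use Suc G_dim V'_max in auto)
    then show ?thesis using Suc by simp
  qed simp
qed

lemma good_hyperplane: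
  assumes "g \<in> G" "g \<noteq> 0"
  obtains H k where "subspace H" "k \<in> G" "k \<notin> H"
    "\<And>h. h \<in> G \<Longrightarrow> h \<notin> H \<Longrightarrow> \<exists>\<psi>. functional \<psi> \<and> (\<forall>M\<in>V. \<psi> (M h) = 0 \<and> \<psi> (M x) + \<phi> (M h) = 0)"
proof -
  obtain H where H: "subspace H" "\<not> G \<subseteq> H" "\<forall>h\<in>G. h \<notin> H \<longrightarrow> adapted G V' h"
    using nonadapted_in_hyperplane[OF G_sub G_dim V'_trivial_spectrum assms] by blast
  obtain k where "k \<in> G" "k \<notin> H" using H(2) by auto
  moreover have "h \<noteq> 0" if "h \<notin> H" for h using that subspace_0[OF H(1)] by auto
  ultimately show ?thesis using that[OF H(1)] H(3) adapted_plane_functional by simp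
qed

text \<open>Outside \<open>H\<close>, put N in place of M in the plane functional: N x = 0 leaves
  only \<phi>(N h) = 0. The identity is linear in \<open>h\<close>, so it extends to
  \<open>G\<close>.\<close>

lemma W_\<phi>:
  assumes N: "N \<in> W" and h: "h \<in> G" shows "\<phi> (N h) = 0"
proof (cases "h = 0")
  case True
  then show ?thesis using V_simps[OF W_V[OF N]] by (simp add: \<phi>_simps)
next
  case False
  obtain H k where H: "subspace H" "k \<in> G" "k \<notin> H"
    "\<And>h. h \<in> G \<Longrightarrow> h \<notin> H \<Longrightarrow> \<exists>\<psi>. functional \<psi> \<and> (\<forall>M\<in>V. \<psi> (M h) = 0 \<and> \<psi> (M x) + \<phi> (M h) = 0)"
    using good_hyperplane[OF h False] by blast
  have *: "\<phi> (N h) = 0" if h: "h \<in> G" "h \<notin> H" for h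
  proof -
    obtain \<psi> where \<psi>: "functional \<psi>" "\<forall>M\<in>V. \<psi> (M h) = 0 \<and> \<psi> (M x) + \<phi> (M h) = 0"
      using H(4)[OF h] by blast
    then have "\<psi> (N x) + \<phi> (N h) = 0" using W_V[OF N] by blast
    then show ?thesis using W_x[OF N] functional_zero[OF \<psi>(1)] by simp
  qed
  show ?thesis
  proof (cases "h \<in> H")
    case True
    then have "h + k \<notin> H" "h + k \<in> G"
      using outside_proper_subspace_spans[OF G_sub H(1,2,3) h] subspace_add[OF G_sub h H(2)] by auto
    then have "\<phi> (N (h + k)) = 0" using * by blast
    then show ?thesis using *[OF H(2,3)] by (simp add: V_simps[OF W_V[OF N]] \<phi>_simps)
  qed (use * h in blast)
qed

lemma decompose: "u = \<phi> u *s x + \<pi> u" by (simp add: \<pi>_def)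

lemma W_\<pi>: "N \<in> W \<Longrightarrow> N (\<pi> u) = N u"
  by (simp add: \<pi>_def V_simps[OF W_V] W_x)

lemma W_G: "N \<in> W \<Longrightarrow> u \<in> U \<Longrightarrow> N u \<in> G"
  using W_\<phi>[OF _ \<pi>_G, of N u] W_\<pi>[of N u] V_U[OF W_V] by (simp add: G_def)

text \<open>By \<open>W_\<phi>\<close> the value does not depend on the operator picked by \<open>SOME\<close>.\<close>

definition \<beta> :: "'b \<Rightarrow> 'b \<Rightarrow> 'a" where
  "\<beta> h c = - \<phi> ((SOME M. M \<in> V \<and> M x = c) h)"

lemma \<beta>_eq:
  assumes "M \<in> V" "h \<in> G" shows "\<beta> h (M x) = - \<phi> (M h)"
proof -
  define N where "N = (SOME N. N \<in> V \<and> N x = M x)"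
  have N: "N \<in> V \<and> N x = M x" unfolding N_def by (rule someI[of _ M]) (use assms in simp)
  then have "N - M \<in> W" using assms op.subspace_diff[OF V_sub] by (auto simp: W_def)
  then have "\<phi> (N h) = \<phi> (M h)" using W_\<phi>[OF _ assms(2)] by (fastforce simp: \<phi>_simps)
  then show ?thesis unfolding \<beta>_def N_def by simp
qed

lemma \<beta>_add_left: "h \<in> G \<Longrightarrow> h' \<in> G \<Longrightarrow> c \<in> G \<Longrightarrow> \<beta> (h + h') c = \<beta> h c + \<beta> h' c"
  and \<beta>_scale_left: "h \<in> G \<Longrightarrow> c \<in> G \<Longrightarrow> \<beta> (a *s h) c = a * \<beta> h c"
  and \<beta>_add_right: "h \<in> G \<Longrightarrow> c \<in> G \<Longrightarrow> c' \<in> G \<Longrightarrow> \<beta> h (c + c') = \<beta> h c + \<beta> h c'"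
  and \<beta>_scale_right: "h \<in> G \<Longrightarrow> c \<in> G \<Longrightarrow> \<beta> h (a *s c) = a * \<beta> h c"
proof -
  show "\<beta> (h + h') c = \<beta> h c + \<beta> h' c" if h: "h \<in> G" "h' \<in> G" "c \<in> G"
  proof -
    obtain M where M: "M \<in> V" "M x = c" using onto_G h by blast
    show ?thesis using \<beta>_eq[OF M(1)] h subspace_add[OF G_sub h(1,2)]
      by (simp add: M(2) V_simps[OF M(1)] \<phi>_simps)
  qed
  show "\<beta> (a *s h) c = a * \<beta> h c" if h: "h \<in> G" "c \<in> G"
  proof -
    obtain M where M: "M \<in> V" "M x = c" using onto_G h by blast
    show ?thesis using \<beta>_eq[OF M(1)] h subspace_scale[OF G_sub h(1)]
      by (simp add: M(2) V_simps[OF M(1)] \<phi>_simps)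
  qed
  show "\<beta> h (c + c') = \<beta> h c + \<beta> h c'" if h: "h \<in> G" "c \<in> G" "c' \<in> G"
  proof -
    obtain M where M: "M \<in> V" "M x = c" using onto_G h by blast
    obtain M' where M': "M' \<in> V" "M' x = c'" using onto_G h by blast
    show ?thesis
      using \<beta>_eq[OF op.subspace_add[OF V_sub M(1) M'(1)] h(1)] \<beta>_eq[OF M(1) h(1)] \<beta>_eq[OF M'(1) h(1)]
      by (simp add: M(2) M'(2) \<phi>_simps)
  qed
  show "\<beta> h (a *s c) = a * \<beta> h c" if h: "h \<in> G" "c \<in> G"
  proof -
    obtain M where M: "M \<in> V" "M x = c" using onto_G h by blast
    show ?thesis
      using \<beta>_eq[OF op.subspace_scale[OF V_sub M(1)] h(1), of a] \<beta>_eq[OF M(1) h(1)]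
      by (simp add: M(2) \<phi>_simps)
  qed
qed

lemma \<beta>_zero_right: "h \<in> G \<Longrightarrow> \<beta> h 0 = 0"
  using \<beta>_scale_right[OF _ subspace_0[OF G_sub], of h 0] by simp

lemma \<beta>_zero_left: "c \<in> G \<Longrightarrow> \<beta> 0 c = 0"
  using \<beta>_scale_left[OF subspace_0[OF G_sub], of c 0] by simp

lemmas \<beta>_simps = \<beta>_add_left \<beta>_scale_left \<beta>_add_right \<beta>_scale_right \<beta>_zero_right \<beta>_zero_left

lemmas G_closed = subspace_add[OF G_sub] subspace_scale[OF G_sub] subspace_0[OF G_sub]
  subspace_diff[OF G_sub]

text \<open>Outside \<open>H\<close>, write N h = M x with M in \<open>V\<close>. Then \<psi>(N h) =
  0 reads \<psi>(M x) = 0, hence \<phi>(M h) = 0, which is the claim by \<open>\<beta>_eq\<close>.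
  The expression is quadratic in \<open>h\<close>, so \<open>quadratic_vanish\<close> carries it
  over to \<open>G\<close>.\<close>

lemma W_alternating:
  assumes N: "N \<in> W" and h: "h \<in> G" shows "\<beta> h (N h) = 0"
proof (cases "h = 0")
  case True
  then show ?thesis using V_simps[OF W_V[OF N]] by (simp add: \<beta>_simps G_closed)
next
  case False
  obtain H k where H: "subspace H" "k \<in> G" "k \<notin> H"
    "\<And>h. h \<in> G \<Longrightarrow> h \<notin> H \<Longrightarrow> \<exists>\<psi>. functional \<psi> \<and> (\<forall>M\<in>V. \<psi> (M h) = 0 \<and> \<psi> (M x) + \<phi> (M h) = 0)"
    using good_hyperplane[OF h False] by blast
  have NG: "N g \<in> G" if "g \<in> G" for g using W_G[OF N G_U[OF that]] .
  have *: "\<beta> h (N h) = 0" if h: "h \<in> G" "h \<notin> H" for h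
  proof -
    obtain \<psi> where \<psi>: "functional \<psi>" "\<forall>M\<in>V. \<psi> (M h) = 0 \<and> \<psi> (M x) + \<phi> (M h) = 0"
      using H(4)[OF h] by blast
    obtain M where M: "M \<in> V" "M x = N h" using onto_G NG h by blast
    have "\<psi> (N h) = 0" using \<psi> W_V[OF N] by blast
    then have "\<phi> (M h) = 0" using \<psi>(2) M by force
    then show ?thesis using \<beta>_eq[OF M(1) h(1)] M(2) by simp
  qed
  show ?thesis
    by (rule quadratic_vanish[OF s G_sub H(1,2,3) _ * h,
        where p = "\<lambda>a b. \<beta> a (N b) + \<beta> b (N a)"])
      (use NG in \<open>simp_all add: V_simps[OF W_V[OF N]] \<beta>_simps G_closed algebra_simps\<close>)
qed

lemma W_skew:
  assumes N: "N \<in> W" and a: "a \<in> G" "b \<in> G" shows "\<beta> a (N b) = - \<beta> b (N a)"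
proof -
  have NG: "N g \<in> G" if "g \<in> G" for g using W_G[OF N G_U[OF that]] .
  have "\<beta> (a + b) (N (a + b)) = 0" using W_alternating[OF N] a G_closed by blast
  then have "\<beta> a (N a) + \<beta> a (N b) + (\<beta> b (N a) + \<beta> b (N b)) = 0"
    using NG a by (simp add: V_simps[OF W_V[OF N]] \<beta>_simps G_closed algebra_simps)
  then show ?thesis using W_alternating[OF N] a by (simp add: eq_neg_iff_add_eq_0)
qed

text \<open>By \<open>W_\<phi>\<close> the space \<open>W\<close> acts on \<open>G\<close> without
  compression, so the dimension results apply to it directly.\<close>

lemma W_trivial_spectrum: "trivial_spectrum_on G W"
  unfolding trivial_spectrum_on_def
proof (intro conjI ballI impI allI)
  show "op.subspace W" by (rule W_sub)
next
  fix N assume N: "N \<in> W"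
  show "lin N" using V_lin[OF W_V[OF N]] .
  show "N g \<in> G" if "g \<in> G" for g using W_G[OF N G_U[OF that]] .
  show "N = 0" if "\<forall>g\<in>G. N g = 0"
  proof (rule trivial_spectrum_onD(4)[OF V W_V[OF N]])
    show "N u = 0" if u: "u \<in> U" for u
      using \<open>\<forall>g\<in>G. N g = 0\<close> \<pi>_G[OF u] W_\<pi>[OF N, of u] by auto
  qed
  show "c = 0" if "g \<in> G" "N g = c *s g" "g \<noteq> 0" for g c
    using trivial_spectrum_onD(5)[OF V W_V[OF N] G_U] that by blast
qed

definition \<Lambda> :: "'b set" where "\<Lambda> = {c \<in> G. \<forall>h\<in>G. \<beta> h c = 0}"

lemma \<Lambda>_sub: "subspace \<Lambda>"
  unfolding subspace_def \<Lambda>_def by (auto simp: \<beta>_simps G_closed)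

lemma \<Lambda>_G: "\<Lambda> \<subseteq> G" by (auto simp: \<Lambda>_def)

end

section \<open>The radical of the form\<close>

context op_space
begin

lemma dim_functionals:
  assumes "finite I" "op.subspace E"
    and "\<And>i M N. i \<in> I \<Longrightarrow> M \<in> E \<Longrightarrow> N \<in> E \<Longrightarrow> f i (M + N) = f i M + f i N"
    and "\<And>i c M. i \<in> I \<Longrightarrow> M \<in> E \<Longrightarrow> f i (opscale c M) = c * f i M"
    and "op.dim_at_most {M \<in> E. \<forall>i\<in>I. f i M = (0::'a)} b"
  shows "op.dim_at_most E (b + card I)"
  using assms
proof (induction I arbitrary: E rule: finite_induct)
  case empty
  then show ?case by simp
next
  case (insert i I)
  let ?E = "{M \<in> E. f i M = 0}"
  have E: "op.subspace ?E"
  proof (rule op.subspaceI)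
    have z: "opscale 0 0 = (0 :: 'b \<Rightarrow> 'b)" by (simp add: fun_eq_iff)
    have "f i 0 = 0"
      using insert.prems(3)[OF insertI1 op.subspace_0[OF insert.prems(1)], of 0] unfolding z by simp
    then show "0 \<in> ?E" using op.subspace_0[OF insert.prems(1)] by simp
    show "M + N \<in> ?E" if "M \<in> ?E" "N \<in> ?E" for M N
      using that insert.prems(2)[OF insertI1, of M N] op.subspace_add[OF insert.prems(1), of M N]
      by (simp add: plus_fun_def)
    show "opscale c M \<in> ?E" if "M \<in> ?E" for c M
      using that insert.prems(3)[OF insertI1, of M c] op.subspace_scale[OF insert.prems(1), of M c] by simp
  qed
  have "{M \<in> ?E. \<forall>i\<in>I. f i M = 0} = {M \<in> E. \<forall>i\<in>insert i I. f i M = 0}" by auto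
  then have "op.dim_at_most ?E (b + card I)"
    using insert.prems by (intro insert.IH[OF E]) auto
  moreover have "fld.dim_at_most (f i ` E) 1"
    by (rule fld.dim_at_mostI[of "{1}"]) (auto simp: fld.span_singleton)
  ultimately have "op.dim_at_most E (1 + (b + card I))"
    by (intro ofl.rank_nullity_bound[OF insert.prems(1), of "f i"])
      (use insert.prems in \<open>auto simp: plus_fun_def\<close>)
  then show ?case using insert.hyps by simp
qed

lemma dim_evaluations:
  assumes "finite C" "op.subspace E" "dim_at_most S k"
    and "\<And>c N. c \<in> C \<Longrightarrow> N \<in> E \<Longrightarrow> N c \<in> S"
    and "op.dim_at_most {N \<in> E. \<forall>c\<in>C. N c = 0} b"
  shows "op.dim_at_most E (b + card C * k)"
  using assms
proof (induction C arbitrary: E rule: finite_induct)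
  case empty
  then show ?case by simp
next
  case (insert c C)
  let ?E = "{N \<in> E. N c = 0}"
  have "{N \<in> ?E. \<forall>c\<in>C. N c = 0} = {N \<in> E. \<forall>c\<in>insert c C. N c = 0}" by auto
  then have "op.dim_at_most ?E (b + card C * k)"
    using insert.prems by (intro insert.IH[OF annihilator_subspace]) auto
  moreover have "dim_at_most ((\<lambda>N. N c) ` E) k"
    using insert.prems(2) by (rule dim_at_most_subset) (use insert.prems(3) in auto)
  ultimately have "op.dim_at_most E (k + (b + card C * k))"
    using dim_sum_annihilator[OF insert.prems(1)] by blast
  then show ?case using insert.hyps by (simp add: algebra_simps)
qed

lemma maxdim_add: "maxdim (a + b) = maxdim a + maxdim b + a * b"
  by (induction a) (simp_all add: maxdim_Suc, simp add: maxdim_def)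

lemma maxdim_sum: "maxdim r = (\<Sum>j<r. j)"
  by (induction r) (simp_all add: maxdim_Suc, simp add: maxdim_def)

end

text \<open>\<open>\<rho>\<close> is a projection onto \<open>U\<close> through which all operators
  of \<open>V\<close> factor. It extends an operator built on \<open>U\<close> to the whole type in
  a canonical way, so that membership in \<open>V\<close> becomes a meaningful question for
  it.\<close>

locale irreducible_trivial_spectrum = maximal_trivial_spectrum scale U V m x \<phi> s
  for scale :: "'a::field \<Rightarrow> 'b::ab_group_add \<Rightarrow> 'b" (infixr "*s" 75)
    and U V m x \<phi> s +
  fixes \<rho> :: "'b \<Rightarrow> 'b"
  assumes \<rho>: "lin \<rho>" "\<And>v. \<rho> v \<in> U" "\<And>u. u \<in> U \<Longrightarrow> \<rho> u = u" "\<And>M v. M \<in> V \<Longrightarrow> M (\<rho> v) = M v"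
    and irreducible: "\<And>S. subspace S \<Longrightarrow> S \<subseteq> U \<Longrightarrow> (\<And>M u. M \<in> V \<Longrightarrow> u \<in> S \<Longrightarrow> M u \<in> S) \<Longrightarrow> S = {0} \<or> S = U"
begin

text \<open>As long as \<open>S\<close> exceeds \<open>\<Lambda>\<close>, some \<open>h\<close> has
  \<open>\<beta> h c \<noteq> 0\<close> for a \<open>c\<close> in \<open>S\<close>, and passing to
  the kernel of \<open>\<beta> h\<close> in \<open>S\<close> lowers the dimension. At most
  \<open>j\<close> such steps fit between the bounds.\<close>

lemma separating_vectors:
  assumes "\<And>k. dim_at_most \<Lambda> k \<Longrightarrow> l \<le> k"
  shows "subspace S \<Longrightarrow> \<Lambda> \<subseteq> S \<Longrightarrow> S \<subseteq> G \<Longrightarrow> dim_at_most S (l + j) \<Longrightarrow>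
    \<exists>hs. length hs \<le> j \<and> set hs \<subseteq> G \<and> (\<forall>c\<in>S. (\<forall>h\<in>set hs. \<beta> h c = 0) \<longrightarrow> c \<in> \<Lambda>)"
proof (induction j arbitrary: S)
  case 0
  have "\<Lambda> = S"
  proof (rule ccontr)
    assume "\<Lambda> \<noteq> S"
    then obtain i where "l + 0 = Suc i" "dim_at_most \<Lambda> i"
      using dim_at_most_psubset[OF \<Lambda>_sub _ 0(4)] 0(2) by blast
    then show False using assms[of i] by simp
  qed
  then show ?case by (intro exI[of _ "[]"]) auto
next
  case (Suc j)
  show ?case
  proof (cases "\<Lambda> = S")
    case True
    then show ?thesis by (intro exI[of _ "[]"]) auto
  next
    case False
    then obtain c where c: "c \<in> S" "c \<notin> \<Lambda>" using Suc.prems by blast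
    then obtain h where h: "h \<in> G" "\<beta> h c \<noteq> 0" using Suc.prems(3) by (auto simp: \<Lambda>_def)
    let ?S = "{c \<in> S. \<beta> h c = 0}"
    have S: "subspace ?S" unfolding subspace_def
      using Suc.prems(1,3) h by (auto simp: \<beta>_simps subspace_def subset_iff)
    moreover have "\<Lambda> \<subseteq> ?S" using Suc.prems(2) h by (auto simp: \<Lambda>_def)
    moreover have "?S \<subseteq> G" using Suc.prems(3) by blast
    moreover have "?S \<subset> S" using c h by blast
    then have "dim_at_most ?S (l + j)"
      using dim_at_most_psubset[OF S _ Suc.prems(4)] by auto
    ultimately obtain hs where hs: "length hs \<le> j" "set hs \<subseteq> G"
      "\<forall>c\<in>?S. (\<forall>h\<in>set hs. \<beta> h c = 0) \<longrightarrow> c \<in> \<Lambda>"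
      using Suc.IH by meson
    show ?thesis by (rule exI[of _ "h # hs"]) (use hs h in auto)
  qed
qed

definition into_\<Lambda> :: "('b \<Rightarrow> 'b) set" where
  "into_\<Lambda> = {N \<in> W. \<forall>k\<in>G. N k \<in> \<Lambda>}"

text \<open>For N in \<open>W\<close> the values of \<open>\<beta>\<close> at h_j and N h_i form an
  alternating matrix of size at most m - l, so the entries with i < j determine it. If they vanish,
  all N h_i lie in \<open>\<Lambda>\<close>, and skewness gives \<beta>(h_i, N k) = - \<beta>(k, N
  h_i) = 0 for every k in \<open>G\<close>: then N maps all of \<open>G\<close> into
  \<open>\<Lambda>\<close>.\<close>

lemma dim_W_into_\<Lambda>:
  assumes \<Lambda>_min: "\<And>k. dim_at_most \<Lambda> k \<Longrightarrow> l \<le> k" and l: "l \<le> m"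
    and b: "op.dim_at_most into_\<Lambda> b"
  shows "op.dim_at_most W (b + maxdim (m - l))"
proof -
  obtain hs where hs: "length hs \<le> m - l" "set hs \<subseteq> G"
      "\<forall>c\<in>G. (\<forall>h\<in>set hs. \<beta> h c = 0) \<longrightarrow> c \<in> \<Lambda>"
    using separating_vectors[OF \<Lambda>_min G_sub \<Lambda>_G subset_refl, of "m - l"] G_dim l by auto
  have hsG: "hs ! i \<in> G" if "i < length hs" for i using hs(2) that by auto
  let ?I = "SIGMA j:{..<length hs}. {..<j}"
  have WG: "N g \<in> G" if "N \<in> W" "g \<in> G" for N g using W_G G_U that by blast
  have "{N \<in> W. \<forall>p\<in>?I. \<beta> (hs ! fst p) (N (hs ! snd p)) = 0} \<subseteq> into_\<Lambda>"
  proof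
    fix N assume "N \<in> {N \<in> W. \<forall>p\<in>?I. \<beta> (hs ! fst p) (N (hs ! snd p)) = 0}"
    then have N: "N \<in> W" and z: "\<And>j i. j < length hs \<Longrightarrow> i < j \<Longrightarrow> \<beta> (hs ! j) (N (hs ! i)) = 0"
      by auto
    have all: "\<beta> (hs ! j) (N (hs ! i)) = 0" if "i < length hs" "j < length hs" for i j
    proof (cases i j rule: linorder_cases)
      case less
      then show ?thesis using z that by blast
    next
      case equal
      then show ?thesis using W_alternating[OF N hsG] that by simp
    next
      case greater
      then show ?thesis using z[of i j] W_skew[OF N hsG hsG, of j i] that by simp
    qed
    have "N (hs ! i) \<in> \<Lambda>" if i: "i < length hs" for i
      using hs(3) WG[OF N hsG[OF i]] all[OF i] by (metis in_set_conv_nth)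
    then have "\<beta> h (N k) = 0" if hk: "h \<in> set hs" "k \<in> G" for h k
    proof -
      obtain i where i: "i < length hs" "h = hs ! i" using hk(1) by (auto simp: in_set_conv_nth)
      have "\<beta> k (N h) = 0" using \<open>\<And>i. i < length hs \<Longrightarrow> N (hs ! i) \<in> \<Lambda>\<close>[OF i(1)] hk(2) i(2)
        by (simp add: \<Lambda>_def)
      then show ?thesis using W_skew[OF N hsG[OF i(1)] hk(2)] i(2) by simp
    qed
    then show "N \<in> into_\<Lambda>" using N WG[OF N] hs(3) by (auto simp: into_\<Lambda>_def)
  qed
  then have "op.dim_at_most {N \<in> W. \<forall>p\<in>?I. \<beta> (hs ! fst p) (N (hs ! snd p)) = 0} b"
    using b op.dim_at_most_subset by blast
  then have "op.dim_at_most W (b + card ?I)"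
    by (intro dim_functionals[OF _ W_sub, of ?I "\<lambda>p N. \<beta> (hs ! fst p) (N (hs ! snd p))"])
      (auto simp: \<beta>_simps hsG WG)
  moreover have "card ?I = maxdim (length hs)" by (simp add: maxdim_sum)
  ultimately show ?thesis using op.dim_at_most_mono maxdim_mono[OF hs(1)] by simp
qed

text \<open>A copy of the space of linear maps from G / \<Lambda> to \<Lambda>, extended by zero at
  \<open>x\<close> and along \<open>\<rho>\<close>.\<close>

definition hom_\<Lambda> :: "('b \<Rightarrow> 'b) set" where
  "hom_\<Lambda> = {N. lin N \<and> N x = 0 \<and> (\<forall>l\<in>\<Lambda>. N l = 0) \<and> (\<forall>v. N v \<in> \<Lambda>) \<and> (\<forall>v. N (\<rho> v) = N v)}"

lemma hom_\<Lambda>_sub: "op.subspace hom_\<Lambda>"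
  unfolding op.subspace_def hom_\<Lambda>_def
  using subspace_0[OF \<Lambda>_sub] subspace_add[OF \<Lambda>_sub] subspace_scale[OF \<Lambda>_sub]
  by (auto simp: lin_iff algebra_simps)

lemma into_\<Lambda>_sub: "op.subspace into_\<Lambda>"
  unfolding op.subspace_def into_\<Lambda>_def
  using subspace_0[OF \<Lambda>_sub] subspace_add[OF \<Lambda>_sub] subspace_scale[OF \<Lambda>_sub]
    op.subspace_0[OF W_sub] op.subspace_add[OF W_sub] op.subspace_scale[OF W_sub]
  by auto

text \<open>\<open>W\<close> splits into three layers: the alternating matrix modulo
  \<open>\<Lambda>\<close>, the restriction to \<open>\<Lambda>\<close> of the operators in
  \<open>into_\<Lambda>\<close>, which has trivial spectrum there, and the operators of
  \<open>into_\<Lambda>\<close> killing \<open>\<Lambda>\<close>, which lie in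
  \<open>hom_\<Lambda>\<close>. With l the dimension of \<open>\<Lambda>\<close>, the bounds maxdim
  (m - l), maxdim l and (m - l) l add up to exactly \<open>maxdim m\<close>, so a last layer
  strictly inside \<open>hom_\<Lambda>\<close> would contradict \<open>W_max\<close>.\<close>

lemma hom_\<Lambda>_subset_W: "hom_\<Lambda> \<subseteq> W"
proof (rule ccontr)
  assume not_sub: "\<not> hom_\<Lambda> \<subseteq> W"
  obtain B where B: "B \<subseteq> \<Lambda>" "independent B" "\<Lambda> \<subseteq> span B"
    by (rule maximal_independent_subset)
  have sB: "span B = \<Lambda>" using B span_minimal[OF B(1) \<Lambda>_sub] by blast
  have "B \<subseteq> G" using B(1) \<Lambda>_G by (rule subset_trans)
  then obtain B' where B': "B \<subseteq> B'" "B' \<subseteq> G" "independent B'" "G \<subseteq> span B'"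
    using B(2) by (rule maximal_independent_subset_extend)
  have fB': "finite B'" "card B' \<le> m" using independent_card_le[OF B'(3,2) G_dim] by auto
  have fB: "finite B" using fB' B' finite_subset by blast
  define l where "l = card B"
  have l: "l \<le> m" using card_mono[OF fB'(1) B'(1)] fB' unfolding l_def by linarith
  have \<Lambda>_dim: "dim_at_most \<Lambda> l" using fB B by (intro dim_at_mostI[of B]) (auto simp: l_def)
  have \<Lambda>_min: "l \<le> k" if "dim_at_most \<Lambda> k" for k
    unfolding l_def by (rule independent_card_le(2)[OF B(2,1) that])
  have C: "finite (B' - B)" "card (B' - B) \<le> m - l"
    using fB' card_Diff_subset[OF fB B'(1)] by (auto simp: l_def)
  have "{N \<in> hom_\<Lambda>. \<forall>c\<in>B' - B. N c = 0} \<subseteq> {0}"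
  proof
    fix N assume "N \<in> {N \<in> hom_\<Lambda>. \<forall>c\<in>B' - B. N c = 0}"
    then have N: "lin N" "N x = 0" "\<And>l. l \<in> \<Lambda> \<Longrightarrow> N l = 0" "\<And>v. N (\<rho> v) = N v"
      "\<And>c. c \<in> B' - B \<Longrightarrow> N c = 0"
      by (auto simp: hom_\<Lambda>_def)
    have NG: "N g = 0" if "g \<in> G" for g
      by (rule lin_eq_0_span[OF N(1), of g B']) (use that B'(4) N(3,5) B(1) in auto)
    have "N v = 0" for v
    proof -
      have "N v = N (\<phi> (\<rho> v) *s x + \<pi> (\<rho> v))" using N(4)[of v] decompose[of "\<rho> v"] by simp
      also have "\<dots> = 0" using NG[OF \<pi>_G[OF \<rho>(2)]] N(2) by (simp add: lin_simps[OF N(1)])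
      finally show ?thesis .
    qed
    then show "N \<in> {0}" by auto
  qed
  then have "op.dim_at_most {N \<in> hom_\<Lambda>. \<forall>c\<in>B' - B. N c = 0} 0"
    by (simp add: op.dim_at_most_zero_iff)
  then have "op.dim_at_most hom_\<Lambda> (0 + card (B' - B) * l)"
    by (intro dim_evaluations[OF C(1) hom_\<Lambda>_sub \<Lambda>_dim]) (auto simp: hom_\<Lambda>_def)
  then have hom_dim: "op.dim_at_most hom_\<Lambda> ((m - l) * l)"
    using op.dim_at_most_mono C(2) by (simp add: mult_le_mono)
  let ?K = "{N \<in> into_\<Lambda>. \<forall>l\<in>\<Lambda>. N l = 0}"
  have K_sub: "op.subspace ?K"
    using into_\<Lambda>_sub unfolding op.subspace_def by auto
  have "?K \<subseteq> hom_\<Lambda>"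
  proof
    fix N assume N: "N \<in> ?K"
    then have NW: "N \<in> W" by (auto simp: into_\<Lambda>_def)
    have "N v \<in> \<Lambda>" for v
      using N \<pi>_G[OF \<rho>(2), of v] W_\<pi>[OF NW, of "\<rho> v"] \<rho>(4)[OF W_V[OF NW], of v]
      unfolding into_\<Lambda>_def by force
    then show "N \<in> hom_\<Lambda>"
      using N V_lin[OF W_V[OF NW]] W_x[OF NW] \<rho>(4)[OF W_V[OF NW]] by (auto simp: hom_\<Lambda>_def)
  qed
  moreover have "?K \<noteq> hom_\<Lambda>" using not_sub by (auto simp: into_\<Lambda>_def)
  ultimately obtain j where j: "(m - l) * l = Suc j" "op.dim_at_most ?K j"
    using op.dim_at_most_psubset[OF K_sub _ hom_dim] by blast
  \<comment> \<open>Composing with a projection onto \<open>\<Lambda>\<close> encodes the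
    restriction of an operator to \<open>\<Lambda>\<close> as a total function determined by its
    values on \<open>\<Lambda>\<close>.\<close>
  obtain \<sigma> where \<sigma>: "lin \<sigma>" "\<And>v. \<sigma> v \<in> \<Lambda>" "\<And>l. l \<in> \<Lambda> \<Longrightarrow> \<sigma> l = l"
  proof -
    obtain \<sigma> where \<sigma>: "lin \<sigma>" "\<And>b. b \<in> B \<Longrightarrow> \<sigma> b = b" "range \<sigma> \<subseteq> span B"
      using vv.linear_independent_extend_subspace[OF B(2), of "\<lambda>b. b"] by auto
    have "\<sigma> l = l" if "l \<in> \<Lambda>" for l
    proof -
      have "lin (\<lambda>v. \<sigma> v - v)" using \<sigma>(1) by (simp add: lin_iff algebra_simps)
      then have "\<sigma> l - l = 0" using lin_eq_0_span[of "\<lambda>v. \<sigma> v - v" l B] that sB \<sigma>(2) by simp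
      then show ?thesis by simp
    qed
    then show ?thesis using that \<sigma> sB by blast
  qed
  let ?F = "(\<lambda>N. N \<circ> \<sigma>) ` into_\<Lambda>"
  have into: "N \<in> V" "l \<in> \<Lambda> \<Longrightarrow> N l \<in> \<Lambda>" if "N \<in> into_\<Lambda>" for N l
    using that W_V \<Lambda>_G by (auto simp: into_\<Lambda>_def)
  have "trivial_spectrum_on \<Lambda> ?F"
    unfolding trivial_spectrum_on_def
  proof (intro conjI ballI impI allI)
    show "op.subspace ?F"
    proof (rule op.subspaceI)
      show "0 \<in> ?F" by (rule image_eqI[OF _ op.subspace_0[OF into_\<Lambda>_sub]]) auto
      fix P assume "P \<in> ?F"
      then obtain N where N: "N \<in> into_\<Lambda>" "P = N \<circ> \<sigma>" by blast
      show "opscale c P \<in> ?F" for c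
        by (rule image_eqI[OF _ op.subspace_scale[OF into_\<Lambda>_sub N(1)]]) (auto simp: N)
      fix Q assume "Q \<in> ?F"
      then obtain N' where N': "N' \<in> into_\<Lambda>" "Q = N' \<circ> \<sigma>" by blast
      show "P + Q \<in> ?F"
        by (rule image_eqI[OF _ op.subspace_add[OF into_\<Lambda>_sub N(1) N'(1)]]) (auto simp: N N')
    qed
  next
    fix P assume "P \<in> ?F"
    then obtain N where N: "N \<in> into_\<Lambda>" "P = N \<circ> \<sigma>" by blast
    show "lin P" using V_lin[OF into(1)[OF N(1)]] \<sigma>(1) N(2) by (auto simp: lin_iff)
    show "P l \<in> \<Lambda>" if "l \<in> \<Lambda>" for l using into(2)[OF N(1) \<sigma>(2)] N(2) by simp
    show "P = 0" if "\<forall>l\<in>\<Lambda>. P l = 0"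
    proof
      fix v
      have "P (\<sigma> v) = 0" using that \<sigma>(2) by blast
      then show "P v = 0 v" using N(2) \<sigma>(3)[OF \<sigma>(2)] by simp
    qed
    show "c = 0" if "l \<in> \<Lambda>" "P l = c *s l" "l \<noteq> 0" for l c
      using trivial_spectrum_onD(5)[OF V into(1)[OF N(1)], of l c] that N(2) \<sigma>(3) \<Lambda>_G G_U by auto
  qed
  then have F_dim: "op.dim_at_most ?F (maxdim l)"
    using trivial_spectrum_dim_subspace[OF \<Lambda>_sub \<Lambda>_dim] by blast
  have "{N \<in> into_\<Lambda>. N \<circ> \<sigma> = 0} \<subseteq> ?K"
  proof
    fix N assume N: "N \<in> {N \<in> into_\<Lambda>. N \<circ> \<sigma> = 0}"
    have "N l = 0" if "l \<in> \<Lambda>" for l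
    proof -
      have "(N \<circ> \<sigma>) l = 0" using N by simp
      then show ?thesis using \<sigma>(3)[OF that] by simp
    qed
    then show "N \<in> ?K" using N by blast
  qed
  then have "op.dim_at_most into_\<Lambda> (maxdim l + j)"
    using op.dim_at_most_subset[OF j(2)]
    by (intro oo.rank_nullity_bound[OF into_\<Lambda>_sub, of "\<lambda>N. N \<circ> \<sigma>"])
      (auto simp: F_dim fun_eq_iff)
  then have "op.dim_at_most W (maxdim l + j + maxdim (m - l))"
    using dim_W_into_\<Lambda> \<Lambda>_min l by blast
  then have "maxdim m \<le> maxdim l + j + maxdim (m - l)"
    using W_max by (simp add: W_def)
  moreover have "maxdim m = maxdim (m - l) + maxdim l + (m - l) * l"
    using maxdim_add[of "m - l" l] l by simp
  ultimately show False using j(1) by simp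
qed

end

section \<open>Construction of the invariant form\<close>

context irreducible_trivial_spectrum
begin

section \<open>Invariance and vanishing of the radical\<close>

lemma \<beta>_diff_right:
  "h \<in> G \<Longrightarrow> c \<in> G \<Longrightarrow> c' \<in> G \<Longrightarrow> \<beta> h (c - c') = \<beta> h c - \<beta> h c'"
  using \<beta>_add_right[of h "c - c'" c'] by (simp add: G_closed)

lemma rank_one_in_V:
  assumes l: "l \<in> \<Lambda>" and y: "functional y" "y x = 0" "\<And>c. c \<in> \<Lambda> \<Longrightarrow> y c = 0"
  shows "(\<lambda>v. y (\<rho> v) *s l) \<in> V"
proof -
  have \<rho>\<rho>: "\<rho> (\<rho> v) = \<rho> v" for v using \<rho>(2,3) by blast
  have "\<rho> x = x" using \<rho>(3) x(1) by blast
  moreover have "\<rho> c = c" if "c \<in> \<Lambda>" for c using \<rho>(3) that \<Lambda>_G G_U by blast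
  ultimately have "(\<lambda>v. y (\<rho> v) *s l) \<in> hom_\<Lambda>"
    using l y subspace_scale[OF \<Lambda>_sub l] lin_add[OF \<rho>(1)] lin_scale[OF \<rho>(1)]
    by (auto simp: hom_\<Lambda>_def lin_iff \<rho>\<rho> functional_simps[OF y(1)] scale_left_distrib)
  then show ?thesis using hom_\<Lambda>_subset_W W_V by blast
qed

text \<open>Since \<open>V\<close> contains all rank-one operators \<open>v \<mapsto> y v * l\<close> with \<open>l \<in> \<Lambda>\<close> and \<open>y\<close> vanishing
  at \<open>x\<close> and on \<open>\<Lambda>\<close>, the inverse of \<open>1 + t M\<close> maps \<open>\<Lambda>\<close> into \<open>K x + \<Lambda>\<close>.\<close>

lemma \<Lambda>_shift:
  assumes M: "M \<in> V" and l: "l \<in> \<Lambda>"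
  shows "\<exists>a. l + a *s x + t *s M (l + a *s x) \<in> \<Lambda>"
proof -
  define F where "F u = u + t *s M u" for u
  have F: "lin F" by (simp add: lin_iff F_def V_simps[OF M] scale_right_distrib algebra_simps)
  have FU: "F u \<in> U" if "u \<in> U" for u
    using that V_U[OF M] U(1) subspace_add subspace_scale by (auto simp: F_def)
  have F_inj: "u = 0" if u: "u \<in> U" "F u = 0" for u
  proof (rule ccontr)
    assume "u \<noteq> 0"
    moreover have "opscale t M u = (-1) *s u" using u(2) by (simp add: F_def eq_neg_iff_add_eq_0 add.commute)
    ultimately show False
      using trivial_spectrum_onD(5)[OF V op.subspace_scale[OF V_sub M] u(1), of t "-1"] by simp
  qed
  let ?S = "{v. \<exists>a. v - a *s x \<in> \<Lambda>}"
  have S: "subspace ?S" by (rule subspace_adjoin[OF \<Lambda>_sub])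
  define Z where "Z = {u \<in> U. F u \<in> \<Lambda>}"
  have Z_sub: "subspace Z" unfolding Z_def subspace_def
    using U(1) \<Lambda>_sub by (auto simp: lin_simps[OF F] subspace_def)
  have ZS: "u \<in> ?S" if u: "u \<in> Z" for u
  proof (rule ccontr)
    assume nS: "u \<notin> ?S"
    then obtain y where y: "functional y" "y u = 1" "\<And>v. v \<in> ?S \<Longrightarrow> y v = 0"
      using exists_complement_functional[OF S] by blast
    have "x \<in> ?S" using subspace_0[OF \<Lambda>_sub] by (auto intro: exI[of _ 1])
    then have yx: "y x = 0" using y(3) by blast
    have "c \<in> ?S" if "c \<in> \<Lambda>" for c using that by (auto intro: exI[of _ 0])
    then have y\<Lambda>: "y c = 0" if "c \<in> \<Lambda>" for c using y(3) that by blast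
    \<comment> \<open>This rank-one operator lies in \<open>V\<close> and sends \<open>u\<close> to
      F u, so t M - N sends \<open>u\<close> to t M u - F u = - u, an eigenvalue that
      \<open>V\<close> forbids.\<close>
    let ?N = "\<lambda>v. y (\<rho> v) *s F u"
    have uU: "u \<in> U" "F u \<in> \<Lambda>" using u by (auto simp: Z_def)
    have "opscale t M - ?N \<in> V"
      by (rule op.subspace_diff[OF V_sub op.subspace_scale[OF V_sub M] rank_one_in_V[OF uU(2) y(1) yx y\<Lambda>]])
    moreover have "(opscale t M - ?N) u = (-1) *s u"
      using \<rho>(3)[OF uU(1)] y(2) by (simp add: F_def)
    moreover have "u \<noteq> 0" using nS subspace_0[OF S] by blast
    ultimately show False using trivial_spectrum_onD(5)[OF V _ uU(1), of "opscale t M - ?N" "-1"] by simp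
  qed
  have \<pi>Z: "\<pi> u \<in> \<Lambda> \<and> u = \<pi> u + \<phi> u *s x" if u: "u \<in> Z" for u
  proof -
    obtain a where a: "u - a *s x \<in> \<Lambda>" using ZS[OF u] by blast
    then have "\<phi> (u - a *s x) = 0" using \<Lambda>_G G_\<phi> by blast
    then have "\<phi> u = a" by (simp add: \<phi>_simps)
    then show ?thesis using a by (simp add: \<pi>_def)
  qed
  have F_onto: "F ` U = U"
  proof (rule ccontr)
    assume "F ` U \<noteq> U"
    then have "F ` U \<subset> U" using FU by blast
    moreover have "subspace (F ` U)" using vv.linear_subspace_image[OF F U(1)] .
    ultimately have "dim_at_most (F ` U) m" using dim_at_most_psubset[OF _ _ U(2)] by blast
    moreover have "{u \<in> U. F u = 0} \<subseteq> {0}" using F_inj by blast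
    then have "dim_at_most {u \<in> U. F u = 0} 0" by (simp add: dim_at_most_zero_iff)
    ultimately have "dim_at_most U (m + 0)"
      by (intro vv.rank_nullity_bound[OF U(1), of F]) (auto simp: lin_simps[OF F])
    then show False using U(3) by fastforce
  qed
  have \<Lambda>_FZ: "\<Lambda> \<subseteq> F ` Z"
  proof
    fix c assume c: "c \<in> \<Lambda>"
    then have "c \<in> F ` U" unfolding F_onto using \<Lambda>_G G_U by blast
    then show "c \<in> F ` Z" using c by (auto simp: Z_def)
  qed
  \<comment> \<open>\<open>\<pi>\<close> is injective on \<open>Z\<close>: if u = \<phi>(u) x lies
    in \<open>Z\<close>, then 0 = \<phi>(F u) = \<phi>(u). Since F maps \<open>Z\<close> onto
    \<open>\<Lambda>\<close>, the image of \<open>Z\<close> under \<open>\<pi>\<close> cannot be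
    smaller than \<open>\<Lambda>\<close>.\<close>
  have "\<pi> ` Z = \<Lambda>"
  proof (rule ccontr)
    assume ne: "\<pi> ` Z \<noteq> \<Lambda>"
    have sub: "\<pi> ` Z \<subset> \<Lambda>" using \<pi>Z ne by blast
    have \<pi>Z_sub: "subspace (\<pi> ` Z)" using vv.linear_subspace_image[OF \<pi>_lin Z_sub] .
    have ker: "{u \<in> Z. \<pi> u = 0} \<subseteq> {0}"
    proof
      fix u assume "u \<in> {u \<in> Z. \<pi> u = 0}"
      then have u: "u \<in> Z" "u = \<phi> u *s x" using \<pi>Z by force+
      have "F (\<phi> u *s x) \<in> \<Lambda>" using u unfolding Z_def by auto
      then have "\<phi> (F (\<phi> u *s x)) = 0" using \<Lambda>_G G_\<phi> by blast
      then have "\<phi> u = 0" using \<phi>(3)[OF M] by (simp add: F_def V_simps[OF M] \<phi>_simps)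
      then show "u \<in> {0}" using u(2) by simp
    qed
    have step: "dim_at_most \<Lambda> k" if k: "dim_at_most (\<pi> ` Z) k" for k
    proof -
      have "dim_at_most {u \<in> Z. \<pi> u = 0} 0" using ker by (simp add: dim_at_most_zero_iff)
      then have "dim_at_most Z (k + 0)"
        by (intro vv.rank_nullity_bound[OF Z_sub, of \<pi>]) (auto simp: lin_simps[OF \<pi>_lin] k)
      then show ?thesis using vv.dim_at_most_image[OF F] \<Lambda>_FZ dim_at_most_subset by simp blast
    qed
    \<comment> \<open>A least bound for \<open>\<Lambda>\<close> cannot exist: the proper subspace
      \<pi>(Z) would obey a smaller one, and \<open>step\<close> passes it back to
      \<open>\<Lambda>\<close>.\<close>
    have "dim_at_most \<Lambda> k" for k
    proof (rule ccontr)
      assume "\<not> dim_at_most \<Lambda> k"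
      have "dim_at_most \<Lambda> m" using G_dim \<Lambda>_G dim_at_most_subset by blast
      then obtain j where "dim_at_most \<Lambda> j" "\<And>i. dim_at_most \<Lambda> i \<Longrightarrow> j \<le> i"
        using ex_has_least_nat[of "dim_at_most \<Lambda>" m "\<lambda>i. i"] by blast
      then show False using dim_at_most_psubset[OF \<pi>Z_sub sub] step by (metis Suc_n_not_le_n)
    qed
    then have "\<Lambda> \<subseteq> {0}" using dim_at_most_zero_iff by blast
    then show False using sub subspace_0[OF \<pi>Z_sub] by blast
  qed
  then obtain u where u: "u \<in> Z" "l = \<pi> u" using l by blast
  have "u = l + \<phi> u *s x" using \<pi>Z[OF u(1)] u(2) by simp
  moreover have "F u \<in> \<Lambda>" using u(1) by (simp add: Z_def)
  ultimately show ?thesis unfolding F_def by metis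
qed

text \<open>Applying \<open>\<phi>\<close> forces the coefficient in \<open>\<Lambda>_shift\<close>
  to be - t \<phi>(M l). Subtracting the results for t = 1 and t = s isolates (s - 1) \<phi>(M l) M
  x in \<open>\<Lambda>\<close>. If \<phi>(M l) were nonzero, M x would lie in the radical, yet
  \<beta>(l, M x) = - \<phi>(M l).\<close>

lemma \<Lambda>_invariant:
  assumes M: "M \<in> V" and l: "l \<in> \<Lambda>" shows "M l \<in> \<Lambda>"
proof -
  have lG: "l \<in> G" using l \<Lambda>_G by blast
  have *: "M l - \<phi> (M l) *s x - (t * \<phi> (M l)) *s M x \<in> \<Lambda>" if t: "t \<noteq> 0" for t
  proof -
    obtain a where a: "l + a *s x + t *s M (l + a *s x) \<in> \<Lambda>" using \<Lambda>_shift[OF M l] by blast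
    then have "\<phi> (l + a *s x + t *s M (l + a *s x)) = 0" using \<Lambda>_G G_\<phi> by blast
    then have "a = - t * \<phi> (M l)"
      using G_\<phi>[OF lG] \<phi>(3)[OF M] by (simp add: V_simps[OF M] \<phi>_simps eq_neg_iff_add_eq_0)
    moreover have "(1 / t) *s ((l + a *s x + t *s M (l + a *s x)) - l) \<in> \<Lambda>"
      using a l \<Lambda>_sub subspace_diff subspace_scale by blast
    ultimately show ?thesis using t by (simp add: V_simps[OF M] algebra_simps)
  qed
  have \<phi>0: "\<phi> (M l) = 0"
  proof (rule ccontr)
    assume nz: "\<phi> (M l) \<noteq> 0"
    have "(M l - \<phi> (M l) *s x - (1 * \<phi> (M l)) *s M x) - (M l - \<phi> (M l) *s x - (s * \<phi> (M l)) *s M x) \<in> \<Lambda>"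
      by (rule subspace_diff[OF \<Lambda>_sub *[OF one_neq_zero] *[OF s(1)]])
    then have "((s - 1) * \<phi> (M l)) *s M x \<in> \<Lambda>" by (simp add: algebra_simps)
    then have "(1 / ((s - 1) * \<phi> (M l))) *s (((s - 1) * \<phi> (M l)) *s M x) \<in> \<Lambda>"
      using subspace_scale[OF \<Lambda>_sub] by blast
    then have "M x \<in> \<Lambda>" using nz s by simp
    then have "\<beta> l (M x) = 0" using lG by (simp add: \<Lambda>_def)
    then show False using \<beta>_eq[OF M lG] nz by simp
  qed
  show ?thesis using *[of 1] \<phi>0 by simp
qed

lemma \<Lambda>_trivial: "\<Lambda> = {0}"
proof -
  have "\<Lambda> \<subseteq> U" using \<Lambda>_G G_U by blast
  then have "\<Lambda> = {0} \<or> \<Lambda> = U" using irreducible[OF \<Lambda>_sub] \<Lambda>_invariant by blast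
  moreover have "x \<notin> \<Lambda>" using \<Lambda>_G G_\<phi> \<phi>(2) by force
  ultimately show ?thesis using x(1) by blast
qed

section \<open>Consequences of nondegeneracy and the form on the whole space\<close>

lemma \<beta>_nondegenerate: "c \<in> G \<Longrightarrow> c \<noteq> 0 \<Longrightarrow> \<exists>h\<in>G. \<beta> h c \<noteq> 0"
  using \<Lambda>_trivial by (auto simp: \<Lambda>_def)

text \<open>If N maps \<open>G\<close> into the line of \<open>h\<close>, pick k' with
  \<open>\<beta> k' h \<noteq> 0\<close>. Alternation at k' gives N k' = 0, and then skewness gives
  \<beta>(k', N k) = 0, so N k = 0 for every k.\<close>

lemma W_all_adapted:
  assumes h: "h \<in> G" "h \<noteq> 0" shows "adapted G W h"
  unfolding adapted_def
proof (intro ballI impI, rule ccontr)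
  fix N assume N: "N \<in> W" "\<forall>g\<in>G. \<exists>a. N g = a *s h" "N \<noteq> 0"
  then obtain k where k: "k \<in> G" "N k \<noteq> 0" using trivial_spectrum_onD(4)[OF W_trivial_spectrum N(1)] by blast
  obtain a where a: "N k = a *s h" using N(2) k(1) by blast
  obtain k' where k': "k' \<in> G" "\<beta> k' h \<noteq> 0" using \<beta>_nondegenerate[OF h] by blast
  obtain a' where a': "N k' = a' *s h" using N(2) k'(1) by blast
  have "a' * \<beta> k' h = 0" using W_alternating[OF N(1) k'(1)] k' h by (simp add: a' \<beta>_simps)
  then have Nk': "N k' = 0" using a' k' by simp
  have "a * \<beta> k' h = \<beta> k' (N k)" using k' h by (simp add: a \<beta>_simps)
  also have "\<dots> = 0" using W_skew[OF N(1) k'(1) k(1)] Nk' k(1) by (simp add: \<beta>_simps)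
  finally show False using k' k a by simp
qed

text \<open>By extremality W h is a hyperplane of \<open>G\<close> missing \<open>h\<close>, so M h
  = a h + N h with N in \<open>W\<close>. Since M - N lies in \<open>V\<close>, its eigenvalue a is
  zero, and alternation of N finishes.\<close>

lemma isotropic_step:
  assumes M: "M \<in> V" and h: "h \<in> G" and \<phi>0: "\<phi> (M h) = 0" shows "\<beta> h (M h) = 0"
proof (cases "h = 0")
  case True
  then show ?thesis by (simp add: V_simps[OF M] \<beta>_simps G_closed)
next
  case False
  have MG: "M h \<in> G" using V_U[OF M G_U[OF h]] \<phi>0 by (simp add: G_def)
  have "m \<noteq> 0"
  proof
    assume "m = 0"
    then have "G \<subseteq> {0}" using G_dim dim_at_most_zero_iff by simp
    then show False using h False by auto
  qed
  then obtain j where j: "m = Suc j" by (cases m) auto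
  have WG: "(\<lambda>N. N h) ` W \<subseteq> G" using W_G G_U[OF h] by blast
  have "\<exists>a. M h - a *s h \<in> (\<lambda>N. N h) ` W"
  proof (rule complement_hyperplane[OF evaluation_subspace[OF W_sub] WG G_sub _ h _ _ MG, of j])
    show "dim_at_most G (Suc j)" using G_dim j by simp
    show "h \<notin> (\<lambda>N. N h) ` W" by (rule evaluation_proper(2)[OF W_trivial_spectrum h False, of j]) (use G_dim j in simp)
    show "j \<le> i" if "dim_at_most ((\<lambda>N. N h) ` W) i" for i
      by (rule maximal_annihilator(1)[OF W_trivial_spectrum G_sub _ h False W_all_adapted[OF h False] _ that])
        (use G_dim W_max j in \<open>auto simp: W_def\<close>)
  qed
  then obtain a N where N: "N \<in> W" "M h - a *s h = N h" by blast
  have "(M - N) h = a *s h" using N(2) by (simp add: algebra_simps)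
  then have "a = 0"
    using trivial_spectrum_onD(5)[OF V op.subspace_diff[OF V_sub M W_V[OF N(1)]] G_U[OF h]] False by blast
  then have "M h = N h" using N(2) by simp
  then show ?thesis using W_alternating[OF N(1) h] by simp
qed

text \<open>For fixed M, the quadratic form on the left vanishes wherever the linear form \<beta>(h,
  M x) = - \<phi>(M h) does, so the latter divides it. The quotient is computed for one operator
  \<open>M0\<close> and shown to be the same for all others.\<close>

lemma exists_\<theta>:
  "\<exists>\<theta>. (\<forall>a\<in>G. \<forall>b\<in>G. \<forall>t. \<theta> (a + t *s b) = \<theta> a + t * \<theta> b) \<and>
    (\<forall>M\<in>V. \<forall>h\<in>G. \<beta> h (\<pi> (M h)) = \<theta> h * \<beta> h (M x))"
proof (cases "G = {0}")
  case True
  then show ?thesis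
    by (intro exI[of _ "\<lambda>_. 0"]) (auto simp: \<beta>_simps G_closed lin_zero[OF \<pi>_lin] V_simps)
next
  case False
  then obtain c where c: "c \<in> G" "c \<noteq> 0" using G_closed(3) by blast
  obtain M0 where M0: "M0 \<in> V" "M0 x = c" using onto_G c by blast
  obtain g where g: "g \<in> G" "\<beta> g c \<noteq> 0" using \<beta>_nondegenerate[OF c] by blast
  define h0 where "h0 = (1 / \<beta> g c) *s g"
  have h0: "h0 \<in> G" "\<beta> h0 c = 1" using g c by (simp_all add: h0_def G_closed \<beta>_simps)
  define P :: "('b \<Rightarrow> 'b) \<Rightarrow> 'b \<Rightarrow> 'b \<Rightarrow> 'a" where "P M a b = \<beta> a (\<pi> (M b))" for M a b
  have \<pi>M: "\<pi> (M g) \<in> G" if "M \<in> V" "g \<in> G" for M g using \<pi>_G V_U G_U that by blast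
  have P_bil: "P M (a + t *s b) (a' + t' *s b') = P M a a' + t' * P M a b' + t * P M b a' + t * t' * P M b b'"
    if "M \<in> V" "a \<in> G" "b \<in> G" "a' \<in> G" "b' \<in> G" for M a b a' b' t t'
    using that \<pi>M
    by (simp add: P_def V_simps lin_simps[OF \<pi>_lin] \<beta>_simps G_closed algebra_simps)
  have P_van: "P M h h = 0" if "M \<in> V" "h \<in> G" "\<beta> h (M x) = 0" for M h
  proof -
    have "\<phi> (M h) = 0" using \<beta>_eq[OF that(1,2)] that(3) by simp
    then show ?thesis using isotropic_step[OF that(1,2)] by (simp add: P_def \<pi>_def)
  qed
  \<comment> \<open>The formula results from expanding the vanishing form \<open>P M0\<close> at h -
    \<beta>(h, c) h0, a vector on which \<beta>(-, c) is zero.\<close>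
  define \<theta> where "\<theta> h = P M0 h0 h + P M0 h h0 - \<beta> h c * P M0 h0 h0" for h
  have P_lin: "P M0 h0 (a + t *s b) = P M0 h0 a + t * P M0 h0 b"
      "P M0 (a + t *s b) h0 = P M0 a h0 + t * P M0 b h0" if "a \<in> G" "b \<in> G" for a b t
    using that \<pi>M[OF M0(1)] h0(1)
    by (simp_all add: P_def V_simps[OF M0(1)] lin_simps[OF \<pi>_lin] \<beta>_simps G_closed)
  have \<theta>_lin: "\<theta> (a + t *s b) = \<theta> a + t * \<theta> b" if "a \<in> G" "b \<in> G" for a b t
    using that c(1) by (simp add: \<theta>_def P_lin \<beta>_simps G_closed algebra_simps)
  have P0: "P M0 h h = \<theta> h * \<beta> h c" if h: "h \<in> G" for h
  proof -
    define f where "f = \<beta> h c"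
    let ?k = "h + (- f) *s h0"
    have k: "?k \<in> G" using h h0 G_closed by blast
    have "\<beta> (h + t *s h0) c = f + t" for t using h h0 c by (simp add: \<beta>_simps G_closed f_def)
    then have "\<beta> ?k c = 0" by (metis add.right_inverse)
    then have "P M0 ?k ?k = 0" using P_van[OF M0(1) k] M0(2) by simp
    then have "P M0 h h - f * P M0 h h0 - f * P M0 h0 h + f * f * P M0 h0 h0 = 0"
      unfolding P_bil[OF M0(1) h h0(1) h h0(1)] by simp
    then show ?thesis unfolding \<theta>_def f_def[symmetric] by (simp add: algebra_simps)
  qed
  have "\<beta> h (\<pi> (M h)) = \<theta> h * \<beta> h (M x)" if M: "M \<in> V" and h: "h \<in> G" for M h
  proof -
    let ?H = "{h \<in> G. \<beta> h c = 0}"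
    let ?q = "\<lambda>h. P M h h - \<theta> h * \<beta> h (M x)"
    have MG: "M x \<in> G" using Mx_G[OF M] .
    have H: "subspace ?H" unfolding subspace_def using c by (auto simp: \<beta>_simps G_closed)
    have h0H: "h0 \<notin> ?H" using h0 by simp
    have van: "?q h = 0" if h: "h \<in> G" "h \<notin> ?H" for h
    proof -
      \<comment> \<open>With this d the operator M - d M0 satisfies the hypothesis of
        \<open>P_van\<close> at \<open>h\<close>, which ties the values of M to those of
        \<open>M0\<close>.\<close>
      define d where "d = \<beta> h (M x) / \<beta> h c"
      have nz: "\<beta> h c \<noteq> 0" using h by simp
      have M': "M - opscale d M0 \<in> V"
        using op.subspace_diff[OF V_sub M op.subspace_scale[OF V_sub M0(1)]] .
      have "\<beta> h ((M - opscale d M0) x) = \<beta> h (M x - d *s c)" using M0(2) by simp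
      also have "\<dots> = \<beta> h (M x) - d * \<beta> h c"
        using h c MG by (simp add: \<beta>_simps \<beta>_diff_right G_closed)
      also have "\<dots> = 0" using nz by (simp add: d_def)
      finally have "P (M - opscale d M0) h h = 0" using P_van[OF M' h(1)] by blast
      moreover have "\<pi> ((M - opscale d M0) h) = \<pi> (M h) - d *s \<pi> (M0 h)"
        by (simp add: lin_simps[OF \<pi>_lin])
      then have "P (M - opscale d M0) h h = P M h h - d * P M0 h h"
        unfolding P_def using h(1) \<pi>M[OF M h(1)] \<pi>M[OF M0(1) h(1)]
        by (simp add: \<beta>_simps \<beta>_diff_right G_closed)
      ultimately have "P M h h = d * P M0 h h" by simp
      then show ?thesis using nz P0[OF h(1)] by (simp add: d_def)
    qed
    have "?q h = 0"
      by (rule quadratic_vanish[OF s G_sub H h0(1) h0H _ van h,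
          where p = "\<lambda>a b. P M a b + P M b a - \<theta> a * \<beta> b (M x) - \<theta> b * \<beta> a (M x)"])
        (simp_all add: P_bil[OF M] \<theta>_lin \<beta>_simps G_closed MG algebra_simps)
    then show ?thesis by (simp add: P_def)
  qed
  then show ?thesis using \<theta>_lin by blast
qed

theorem exists_invariant_form:
  "\<exists>b. (\<forall>u\<in>U. \<forall>v\<in>U. \<forall>w\<in>U. \<forall>t. b (u + t *s v) w = b u w + t * b v w) \<and>
    (\<forall>u\<in>U. \<forall>v\<in>U. \<forall>w\<in>U. \<forall>t. b w (u + t *s v) = b w u + t * b w v) \<and>
    (\<forall>M\<in>V. \<forall>u\<in>U. b u (M u) = 0) \<and>
    (\<forall>v\<in>U. (\<forall>u\<in>U. b u v = 0) \<longrightarrow> v = 0)"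
proof -
  obtain \<theta> where \<theta>: "\<And>a b t. a \<in> G \<Longrightarrow> b \<in> G \<Longrightarrow> \<theta> (a + t *s b) = \<theta> a + t * \<theta> b"
      "\<And>M h. M \<in> V \<Longrightarrow> h \<in> G \<Longrightarrow> \<beta> h (\<pi> (M h)) = \<theta> h * \<beta> h (M x)"
    using exists_\<theta> by blast
  \<comment> \<open>With respect to K x + G the blocks are b(x, x) = 1, b(x, c) = 0, b(h, x) =
    \<theta>(h) and b(h, c) = \<beta>(h, c). The middle term is there because \<phi>(M u) = -
    \<beta>(h, M x) for h = \<pi>(u): it cancels the contribution \<theta>(h) \<beta>(h, M x) of
    \<pi>(M h).\<close>
  define b where "b u v = \<phi> u * \<phi> v + \<phi> v * \<theta> (\<pi> u) + \<beta> (\<pi> u) (\<pi> v)" for u v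
  have "b (u + t *s v) w = b u w + t * b v w" if "u \<in> U" "v \<in> U" "w \<in> U" for u v w t
    using that by (simp add: b_def lin_simps[OF \<pi>_lin] \<phi>_simps \<theta> \<beta>_simps G_closed \<pi>_G algebra_simps)
  moreover have "b w (u + t *s v) = b w u + t * b w v" if "u \<in> U" "v \<in> U" "w \<in> U" for u v w t
    using that by (simp add: b_def lin_simps[OF \<pi>_lin] \<phi>_simps \<beta>_simps G_closed \<pi>_G algebra_simps)
  moreover have "b u (M u) = 0" if M: "M \<in> V" and u: "u \<in> U" for M u
  proof -
    let ?h = "\<pi> u"
    have h: "?h \<in> G" using \<pi>_G[OF u] .
    have Mu: "M u = \<phi> u *s M x + M ?h" by (subst decompose) (simp add: V_simps[OF M])
    have \<phi>M: "\<phi> (M u) = - \<beta> ?h (M x)"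
      using \<beta>_eq[OF M h] \<phi>(3)[OF M] by (simp add: Mu \<phi>_simps)
    have "\<pi> (M u) = \<phi> u *s M x + \<pi> (M ?h)"
      using \<pi>_id[OF Mx_G[OF M]] by (simp add: Mu lin_simps[OF \<pi>_lin])
    then have "\<beta> ?h (\<pi> (M u)) = \<phi> u * \<beta> ?h (M x) + \<theta> ?h * \<beta> ?h (M x)"
      using h Mx_G[OF M] \<pi>_G[OF V_U[OF M G_U[OF h]]] \<theta>(2)[OF M h] by (simp add: \<beta>_simps G_closed)
    then show ?thesis by (simp add: b_def \<phi>M algebra_simps)
  qed
  moreover have "v = 0" if v: "v \<in> U" "\<forall>u\<in>U. b u v = 0" for v
  proof -
    have \<theta>0: "\<theta> 0 = 0" using \<theta>(1)[OF G_closed(3) G_closed(3), of "-1"] by simp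
    have "\<pi> x = 0" by (simp add: \<pi>_def \<phi>(2))
    then have \<phi>v: "\<phi> v = 0"
      using bspec[OF v(2) x(1)] \<pi>_G[OF v(1)] by (simp add: b_def \<phi>(2) \<theta>0 \<beta>_simps)
    have vG: "v \<in> G" using v(1) \<phi>v by (simp add: G_def)
    have "\<beta> h v = 0" if "h \<in> G" for h
      using bspec[OF v(2) G_U[OF that]] \<pi>_id[OF that] \<pi>_id[OF vG] \<phi>v by (simp add: b_def)
    then show ?thesis using \<beta>_nondegenerate[OF vG] by blast
  qed
  ultimately show ?thesis by (intro exI[of _ b]) simp
qed

end

section \<open>From operators to matrices\<close>

context op_space
begin

theorem maximal_irreducible_form:
  assumes U: "subspace U" "dim_at_most U (Suc m)" "\<And>k. dim_at_most U k \<Longrightarrow> Suc m \<le> k"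
    and V: "trivial_spectrum_on U V" "\<And>k. op.dim_at_most V k \<Longrightarrow> maxdim (Suc m) \<le> k"
    and s: "s \<noteq> (0::'a)" "s \<noteq> 1"
    and \<rho>: "lin \<rho>" "\<And>v. \<rho> v \<in> U" "\<And>u. u \<in> U \<Longrightarrow> \<rho> u = u" "\<And>M v. M \<in> V \<Longrightarrow> M (\<rho> v) = M v"
    and irr: "\<And>S. subspace S \<Longrightarrow> S \<subseteq> U \<Longrightarrow> (\<And>M u. M \<in> V \<Longrightarrow> u \<in> S \<Longrightarrow> M u \<in> S) \<Longrightarrow> S = {0} \<or> S = U"
  shows "\<exists>b. (\<forall>u\<in>U. \<forall>v\<in>U. \<forall>w\<in>U. \<forall>t. b (u + t *s v) w = b u w + t * b v w) \<and>
    (\<forall>u\<in>U. \<forall>v\<in>U. \<forall>w\<in>U. \<forall>t. b w (u + t *s v) = b w u + t * b w v) \<and>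
    (\<forall>M\<in>V. \<forall>u\<in>U. b u (M u) = 0) \<and>
    (\<forall>v\<in>U. (\<forall>u\<in>U. b u v = 0) \<longrightarrow> v = 0)"
proof -
  obtain B where B: "finite B" "card B \<le> Suc m" "independent B" "span B = U"
    by (rule dim_at_most_basis[OF U(1,2)])
  have "B \<noteq> {}"
  proof
    assume "B = {}"
    then have "U \<subseteq> {0}" using B(4) by simp
    then have "dim_at_most U 0" by (simp add: dim_at_most_zero_iff)
    then show False using U(3) by fastforce
  qed
  then obtain x where x: "x \<in> B" "adapted U V x"
    using exists_adapted[of B V] V(1) B by blast
  have xU: "x \<in> U" "x \<noteq> 0" using x(1) B(3,4) span_base dependent_zero by auto
  let ?Vx = "(\<lambda>M. M x) ` V"
  note max = maximal_annihilator[OF V(1) U(1,2) xU x(2) V(2)]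
  have Vx: "subspace ?Vx" "x \<notin> ?Vx" "?Vx \<subseteq> U"
    using evaluation_subspace[OF trivial_spectrum_onD(1)[OF V(1)]] evaluation_proper(2)[OF V(1) xU U(2)]
      trivial_spectrum_onD(3)[OF V(1) _ xU(1)] by auto
  obtain \<phi> where \<phi>: "functional \<phi>" "\<phi> x = 1" "\<And>v. v \<in> ?Vx \<Longrightarrow> \<phi> v = 0"
    using exists_complement_functional[OF Vx(1,2)] by blast
  interpret irreducible_trivial_spectrum scale U V m x \<phi> s \<rho>
  proof unfold_locales
    \<comment> \<open>V x has dimension at least \<open>m\<close> and misses \<open>x\<close>, so U
      = V x + K x; applying \<open>\<phi>\<close> removes the component along
      \<open>x\<close>.\<close>
    show "\<exists>M\<in>V. M x = u" if u: "u \<in> U" "\<phi> u = 0" for u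
    proof -
      obtain a where a: "u - a *s x \<in> ?Vx"
        using complement_hyperplane[OF Vx(1,3) U(1,2) xU(1) Vx(2) max(1) u(1)] by blast
      have "a = 0" using \<phi>(3)[OF a] u(2) \<phi>(2) by (simp add: functional_simps[OF \<phi>(1)])
      then show ?thesis using a by auto
    qed
  qed (use U V(1) xU x(2) \<phi> max(2) s \<rho> irr in
      \<open>auto simp: functional_simps[OF \<phi>(1)] lin_simps[OF \<rho>(1)]\<close>)
  show ?thesis by (rule exists_invariant_form)
qed

end

section \<open>Matrices as operators on functions of finite support\<close>

interpretation fn: op_space "\<lambda>c (f :: nat \<Rightarrow> 'a::field) i. c * f i"
  by unfold_locales (simp_all add: fun_eq_iff algebra_simps)

text \<open>Vectors of length \<open>n\<close> become functions vanishing from index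
  \<open>n\<close> on, so that they sit inside one type carrying the vector space structure that
  \<open>op_space\<close> requires.\<close>

definition coord_space :: "nat \<Rightarrow> (nat \<Rightarrow> 'a::field) set" where
  "coord_space n = {f. \<forall>i\<ge>n. f i = 0}"

definition truncate_fn :: "nat \<Rightarrow> (nat \<Rightarrow> 'a::field) \<Rightarrow> nat \<Rightarrow> 'a" where
  "truncate_fn n f i = (if i < n then f i else 0)"

text \<open>Only the first \<open>n\<close> coordinates are read and written; hence the operator
  factors through \<open>truncate_fn n\<close>, which later serves as the projection
  \<open>\<rho>\<close>.\<close>

definition op_of_mat :: "nat \<Rightarrow> 'a::field mat \<Rightarrow> (nat \<Rightarrow> 'a) \<Rightarrow> nat \<Rightarrow> 'a" where
  "op_of_mat n M f i = (if i < n then \<Sum>j<n. M $$ (i, j) * f j else 0)"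

definition unit_fn :: "nat \<Rightarrow> nat \<Rightarrow> 'a::field" where
  "unit_fn j i = (if i = j then 1 else 0)"

lemma subspace_coord_space: "fn.subspace (coord_space n)"
  by (auto simp: fn.subspace_def coord_space_def)

lemma coord_space_dim: "fn.dim_at_most (coord_space n :: (nat \<Rightarrow> 'a::field) set) n"
proof (induction n)
  case 0
  have "coord_space 0 \<subseteq> {0 :: nat \<Rightarrow> 'a}" by (auto simp: coord_space_def fun_eq_iff)
  then show ?case by (simp add: fn.dim_at_most_zero_iff)
next
  case (Suc n)
  have "coord_space (Suc n) \<subseteq> {v. \<exists>a. v - (\<lambda>i. a * unit_fn n i) \<in> (coord_space n :: (nat \<Rightarrow> 'a) set)}"
  proof
    fix f :: "nat \<Rightarrow> 'a" assume "f \<in> coord_space (Suc n)"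
    then have "f - (\<lambda>i. f n * unit_fn n i) \<in> coord_space n"
      by (auto simp: coord_space_def unit_fn_def Suc_le_eq)
    then show "f \<in> {v. \<exists>a. v - (\<lambda>i. a * unit_fn n i) \<in> coord_space n}" by blast
  qed
  then show ?case using fn.dim_at_most_subset[OF fn.dim_at_most_insert[OF Suc]] by blast
qed

lemma coord_space_dim_min:
  "fn.dim_at_most (coord_space n :: (nat \<Rightarrow> 'a::field) set) k \<Longrightarrow> n \<le> k"
proof (induction n arbitrary: k)
  case (Suc n)
  have "(unit_fn n :: nat \<Rightarrow> 'a) \<in> coord_space (Suc n)" "(unit_fn n :: nat \<Rightarrow> 'a) \<notin> coord_space n"
    by (auto simp: coord_space_def unit_fn_def)
  moreover have "(coord_space n :: (nat \<Rightarrow> 'a) set) \<subseteq> coord_space (Suc n)"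
    by (auto simp: coord_space_def)
  ultimately have "(coord_space n :: (nat \<Rightarrow> 'a) set) \<subset> coord_space (Suc n)" by blast
  then obtain j where "k = Suc j" "fn.dim_at_most (coord_space n :: (nat \<Rightarrow> 'a) set) j"
    using fn.dim_at_most_psubset[OF subspace_coord_space _ Suc.prems] by blast
  then show ?case using Suc.IH by simp
qed simp

lemma op_of_mat_lin: "fn.lin (op_of_mat n M)"
  unfolding fn.lin_iff
  by (auto simp: op_of_mat_def fun_eq_iff distrib_left sum.distrib sum_distrib_left mult.left_commute)

lemma op_of_mat_coord_space: "op_of_mat n M f \<in> coord_space n"
  by (simp add: coord_space_def op_of_mat_def)

lemma op_of_mat_truncate: "op_of_mat n M (truncate_fn n f) = op_of_mat n M f"
  by (simp add: op_of_mat_def truncate_fn_def fun_eq_iff)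

lemma truncate_props:
  "fn.lin (truncate_fn n)" "truncate_fn n f \<in> coord_space n" "f \<in> coord_space n \<Longrightarrow> truncate_fn n f = f"
  by (auto simp: fn.lin_iff truncate_fn_def coord_space_def fun_eq_iff)

lemma op_of_mat_unit_fn: "j < n \<Longrightarrow> i < n \<Longrightarrow> op_of_mat n M (unit_fn j) i = M $$ (i, j)"
  by (simp add: op_of_mat_def unit_fn_def if_distrib cong: if_cong)

lemma op_of_mat_add: "A \<in> carrier_mat n n \<Longrightarrow> B \<in> carrier_mat n n \<Longrightarrow> op_of_mat n (A + B) = op_of_mat n A + op_of_mat n B"
  by (auto simp: op_of_mat_def fun_eq_iff distrib_right sum.distrib)

lemma op_of_mat_smult: "A \<in> carrier_mat n n \<Longrightarrow> op_of_mat n (c \<cdot>\<^sub>m A) = (\<lambda>f i. c * op_of_mat n A f i)"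
  by (auto simp: op_of_mat_def fun_eq_iff sum_distrib_left mult.assoc)

lemma op_of_mat_zero: "op_of_mat n (0\<^sub>m n n) = 0"
  by (auto simp: op_of_mat_def fun_eq_iff)

lemma op_of_mat_inj:
  assumes "A \<in> carrier_mat n n" "B \<in> carrier_mat n n" "op_of_mat n A = op_of_mat n B" shows "A = B"
proof (rule eq_matI)
  show "A $$ (i, j) = B $$ (i, j)" if "i < dim_row B" "j < dim_col B" for i j
    using that assms op_of_mat_unit_fn[of j n i A] op_of_mat_unit_fn[of j n i B] by simp
qed (use assms in auto)

lemma vec_op_of_mat:
  assumes "M \<in> carrier_mat n n"
  shows "vec n (op_of_mat n M f) = M *\<^sub>v vec n f"
  using assms by (auto simp: op_of_mat_def scalar_prod_def lessThan_atLeast0)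

lemma coord_space_vec_inj:
  assumes "f \<in> coord_space n" "g \<in> coord_space n" "vec n f = vec n g" shows "f = g"
proof
  fix i
  show "f i = g i"
  proof (cases "i < n")
    case True
    then show ?thesis using arg_cong[OF assms(3), of "\<lambda>v. v $ i"] by simp
  next
    case False
    then show ?thesis using assms(1,2) by (simp add: coord_space_def)
  qed
qed

lemma mat_subspaceD:
  assumes "mat_subspace n V"
  shows "V \<subseteq> carrier_mat n n" "0\<^sub>m n n \<in> V" "A \<in> V \<Longrightarrow> B \<in> V \<Longrightarrow> A + B \<in> V"
    "A \<in> V \<Longrightarrow> c \<cdot>\<^sub>m A \<in> V"
proof -
  interpret submodule class_ring V "module_mat TYPE('a) n n"
    using assms by (simp add: VectorSpace.subspace_def)
  show "V \<subseteq> carrier_mat n n" "0\<^sub>m n n \<in> V" "A \<in> V \<Longrightarrow> B \<in> V \<Longrightarrow> A + B \<in> V"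
    "A \<in> V \<Longrightarrow> c \<cdot>\<^sub>m A \<in> V"
    using subset zero_closed m_closed[of A B] smult_closed[of c A] by (auto simp: module_mat_simps)
qed

lemma op_of_mat_subspace:
  assumes "V \<subseteq> carrier_mat n n" "0\<^sub>m n n \<in> V" "\<And>A B. A \<in> V \<Longrightarrow> B \<in> V \<Longrightarrow> A + B \<in> V"
    "\<And>A c. A \<in> V \<Longrightarrow> c \<cdot>\<^sub>m A \<in> V"
  shows "fn.op.subspace (op_of_mat n ` V)"
proof (rule fn.op.subspaceI)
  show "0 \<in> op_of_mat n ` V" using imageI[OF assms(2), of "op_of_mat n"] by (simp add: op_of_mat_zero)
  show "P + Q \<in> op_of_mat n ` V" if PQ: "P \<in> op_of_mat n ` V" "Q \<in> op_of_mat n ` V" for P Q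
  proof -
    obtain A B where AB: "A \<in> V" "B \<in> V" "P = op_of_mat n A" "Q = op_of_mat n B" using PQ by blast
    have c: "A \<in> carrier_mat n n" "B \<in> carrier_mat n n" using AB assms(1) by blast+
    have "P + Q = op_of_mat n (A + B)" unfolding AB(3,4) op_of_mat_add[OF c] ..
    then show ?thesis using assms(3)[OF AB(1,2)] by blast
  qed
  show "(\<lambda>v i. c * P v i) \<in> op_of_mat n ` V" if P: "P \<in> op_of_mat n ` V" for c P
  proof -
    obtain A where A: "A \<in> V" "P = op_of_mat n A" using P by blast
    have Ac: "A \<in> carrier_mat n n" using A(1) assms(1) by blast
    have "(\<lambda>v i. c * P v i) = op_of_mat n (c \<cdot>\<^sub>m A)" unfolding A(2) op_of_mat_smult[OF Ac] ..
    then show ?thesis using assms(4)[OF A(1)] by blast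
  qed
qed

text \<open>Preimages of a basis of the operator space generate \<open>V\<close>. Besides giving the
  bound, this yields extremality: if the matrix dimension equals \<open>maxdim n\<close>, no smaller
  bound holds for the operators.\<close>

lemma mat_subspace_dim_le:
  assumes V: "mat_subspace n V" and k: "fn.op.dim_at_most (op_of_mat n ` V) k"
  shows "mat_subspace_dim n V \<le> k"
proof -
  note VD = mat_subspaceD[OF V]
  have Vs: "vectorspace class_ring ((module_mat TYPE('a) n n)\<lparr>carrier := V\<rparr>)"
    using vectorspace.subspace_is_vs[OF matrix_vs V] .
  interpret vs: vectorspace class_ring "(module_mat TYPE('a) n n)\<lparr>carrier := V\<rparr>" by (rule Vs)
  obtain B where B: "finite B" "card B \<le> k" "fn.op.independent B" "fn.op.span B = op_of_mat n ` V"
    by (rule fn.op.dim_at_most_basis[OF op_of_mat_subspace[OF VD] k])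
  have "B \<subseteq> op_of_mat n ` V" using fn.op.span_superset[of B] unfolding B(4) .
  then obtain A where A: "A \<subseteq> V" "finite A" "B = op_of_mat n ` A" "card A = card B"
    by (metis B(1) card_image finite_image_iff subset_image_inj)
  have AV: "A \<subseteq> carrier ((module_mat TYPE('a) n n)\<lparr>carrier := V\<rparr>)" using A(1) by simp
  interpret sp: submodule class_ring "vs.span A" "(module_mat TYPE('a) n n)\<lparr>carrier := V\<rparr>"
    by (rule vs.span_is_submodule[OF AV])
  have spV: "vs.span A \<subseteq> V" using sp.subset by simp
  have ex: "\<exists>M\<in>vs.span A. op_of_mat n M = P" if "P \<in> fn.op.span (op_of_mat n ` A)" for P
    using that
  proof (induction rule: fn.op.span_induct_alt)
    case base
    have "0\<^sub>m n n \<in> vs.span A" using sp.zero_closed by (simp add: module_mat_simps)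
    then show ?case using op_of_mat_zero by blast
  next
    case (step c P Q)
    then obtain M N where MN: "M \<in> A" "P = op_of_mat n M" "N \<in> vs.span A" "op_of_mat n N = Q" by blast
    have M: "M \<in> vs.span A" using vs.in_own_span[OF AV] MN(1) by blast
    have "c \<cdot>\<^sub>m M \<in> vs.span A" using sp.smult_closed[of c M] M by (simp add: module_mat_simps)
    then have "c \<cdot>\<^sub>m M + N \<in> vs.span A" using sp.m_closed MN(3) by (simp add: module_mat_simps)
    moreover have "M \<in> carrier_mat n n" "N \<in> carrier_mat n n"
      using M MN(3) spV VD(1) by auto
    then have "op_of_mat n (c \<cdot>\<^sub>m M + N) = (\<lambda>v i. c * P v i) + Q"
      using MN by (simp add: op_of_mat_add op_of_mat_smult)
    ultimately show ?case by blast
  qed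
  have "V \<subseteq> vs.span A"
  proof
    fix M assume M: "M \<in> V"
    then obtain N where N: "N \<in> vs.span A" "op_of_mat n N = op_of_mat n M" using ex[of "op_of_mat n M"] B(4) A(3) by auto
    then have "N = M" using op_of_mat_inj[of N n M] VD(1) spV M by blast
    then show "M \<in> vs.span A" using N by simp
  qed
  then have "vs.gen_set A" using spV by auto
  then have "vs.dim \<le> card A" using vs.gen_ge_dim[OF A(2) AV] by blast
  then show ?thesis using A(4) B(2) by simp
qed

lemma op_of_mat_trivial_spectrum:
  assumes V: "mat_subspace n V" "trivial_spectrum V"
  shows "fn.trivial_spectrum_on (coord_space n) (op_of_mat n ` V)"
  unfolding fn.trivial_spectrum_on_def
proof (intro conjI ballI impI allI)
  note VD = mat_subspaceD[OF V(1)]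
  show "fn.op.subspace (op_of_mat n ` V)" using op_of_mat_subspace[OF VD] .
  fix P assume "P \<in> op_of_mat n ` V"
  then obtain M where M: "M \<in> V" "P = op_of_mat n M" by blast
  have Mc: "M \<in> carrier_mat n n" using M VD(1) by blast
  show "fn.lin P" using M op_of_mat_lin by simp
  show "P u \<in> coord_space n" for u using M op_of_mat_coord_space by simp
  show "P = 0" if "\<forall>u\<in>coord_space n. P u = 0"
  proof
    fix v
    show "P v = 0 v" using that truncate_props(2)[of n v] op_of_mat_truncate[of n M v] M by auto
  qed
  show "c = 0" if u: "u \<in> coord_space n" and eq: "P u = (\<lambda>i. c * u i)" and "u \<noteq> 0" for u c
  proof (rule ccontr)
    assume c: "c \<noteq> 0"
    have "M *\<^sub>v vec n u = vec n (\<lambda>i. c * u i)" using vec_op_of_mat[OF Mc, of u] eq M by simp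
    also have "\<dots> = c \<cdot>\<^sub>v vec n u" by auto
    finally have "M *\<^sub>v vec n u = c \<cdot>\<^sub>v vec n u" .
    moreover have "vec n u \<noteq> 0\<^sub>v n"
    proof
      assume "vec n u = 0\<^sub>v n"
      then have "vec n u = vec n 0" by (auto simp: zero_vec_def zero_fun_def)
      then have "u = 0" using coord_space_vec_inj[OF u] fn.subspace_0[OF subspace_coord_space] by blast
      then show False using that by simp
    qed
    ultimately have "eigenvalue M c" using Mc
      by (auto simp: eigenvalue_def eigenvector_def intro!: exI[of _ "vec n u"])
    then show False using V(2) M(1) c by (auto simp: trivial_spectrum_def)
  qed
qed

lemma op_of_mat_irreducible:
  assumes V: "V \<subseteq> carrier_mat n n" "irreducible_mats n V"
    and S: "fn.subspace S" "S \<subseteq> coord_space n" "\<And>P u. P \<in> op_of_mat n ` V \<Longrightarrow> u \<in> S \<Longrightarrow> P u \<in> S"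
  shows "S = {0} \<or> S = coord_space n"
proof -
  let ?W = "vec n ` S"
  interpret vec_space "TYPE('a)" n .
  have sub: "vec_subspace n ?W"
    unfolding VectorSpace.subspace_def submodule_def module_vec_simps class_ring_simps
  proof (intro conjI allI impI)
    show "vectorspace class_ring (module_vec TYPE('a) n)" by (rule vec_vs)
    then show "Module.module class_ring (module_vec TYPE('a) n)" by (simp add: vectorspace_def)
    show "?W \<subseteq> carrier_vec n" by auto
    show "0\<^sub>v n \<in> ?W"
      by (rule image_eqI[OF _ fn.subspace_0[OF S(1)]]) (auto simp: zero_vec_def zero_fun_def)
    show "v + w \<in> ?W" if vw: "v \<in> ?W" "w \<in> ?W" for v w
    proof -
      obtain f g where fg: "f \<in> S" "g \<in> S" "v = vec n f" "w = vec n g" using vw by blast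
      show ?thesis by (rule image_eqI[OF _ fn.subspace_add[OF S(1) fg(1,2)]]) (auto simp: fg)
    qed
    show "c \<cdot>\<^sub>v v \<in> ?W" if v: "v \<in> ?W" for c v
    proof -
      obtain f where f: "f \<in> S" "v = vec n f" using v by blast
      show ?thesis by (rule image_eqI[OF _ fn.subspace_scale[OF S(1) f(1), of c]]) (auto simp: f)
    qed
  qed
  have inv: "A *\<^sub>v v \<in> ?W" if Av: "A \<in> V" "v \<in> ?W" for A v
  proof -
    obtain f where f: "f \<in> S" "v = vec n f" using Av by blast
    have "A *\<^sub>v v = vec n (op_of_mat n A f)" using vec_op_of_mat[of A n f] V(1) Av(1) f(2) by auto
    then show ?thesis using S(3) Av(1) f(1) by blast
  qed
  have "?W = {0\<^sub>v n} \<or> ?W = carrier_vec n"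
    using V(2) sub inv unfolding irreducible_mats_def by blast
  then show ?thesis
  proof
    assume W: "?W = {0\<^sub>v n}"
    have z: "0\<^sub>v n = vec n (0 :: nat \<Rightarrow> 'a)" by (auto simp: zero_vec_def zero_fun_def)
    have "f = 0" if "f \<in> S" for f
    proof (rule coord_space_vec_inj)
      show "f \<in> coord_space n" using that S(2) by blast
      show "0 \<in> coord_space n" using fn.subspace_0[OF subspace_coord_space] .
      show "vec n f = vec n 0" using W that z by (metis imageI singletonD)
    qed
    then show ?thesis using fn.subspace_0[OF S(1)] by blast
  next
    assume W: "?W = carrier_vec n"
    have "f \<in> S" if f: "f \<in> coord_space n" for f
    proof -
      have "vec n f \<in> ?W" using W by simp
      then obtain g where g: "g \<in> S" "vec n f = vec n g" by blast
      then show ?thesis using coord_space_vec_inj[OF f _ g(2)] S(2) by blast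
    qed
    then show ?thesis using S(2) by blast
  qed
qed

section \<open>The classification\<close>

lemma alternatingD:
  assumes "A \<in> alternating_mats n"
  shows "A \<in> carrier_mat n n" "i < n \<Longrightarrow> j < n \<Longrightarrow> A $$ (j, i) = - A $$ (i, j)"
    "i < n \<Longrightarrow> A $$ (i, i) = 0"
proof -
  show A: "A \<in> carrier_mat n n" "i < n \<Longrightarrow> A $$ (i, i) = 0"
    using assms by (auto simp: alternating_mats_def)
  show "A $$ (j, i) = - A $$ (i, j)" if "i < n" "j < n"
  proof -
    have "transpose_mat A $$ (i, j) = (- A) $$ (i, j)" using assms by (simp add: alternating_mats_def)
    then show ?thesis using that A by simp
  qed
qed

lemma alternatingI:
  assumes "A \<in> carrier_mat n n" "\<And>i j. i < n \<Longrightarrow> j < n \<Longrightarrow> A $$ (j, i) = - A $$ (i, j)"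
    "\<And>i. i < n \<Longrightarrow> A $$ (i, i) = 0"
  shows "A \<in> alternating_mats n"
proof -
  have "transpose_mat A = - A"
  proof (rule eq_matI)
    fix i j assume "i < dim_row (- A)" "j < dim_col (- A)"
    then show "transpose_mat A $$ (i, j) = (- A) $$ (i, j)"
      using assms(1) assms(2)[of i j] by simp
  qed (use assms(1) in auto)
  then show ?thesis using assms(1,3) by (simp add: alternating_mats_def)
qed

text \<open>Since \<open>Q\<close> cancels \<open>P\<close>, the functional with index (j, i) reads
  the entry of A at (i, j) back from the operator of P A. The entries above the diagonal,
  \<open>maxdim n\<close> in number, determine an alternating matrix.\<close>

lemma alternating_image_dim:
  fixes P Q :: "'a::field mat"
  assumes P: "P \<in> carrier_mat n n" and Q: "Q \<in> carrier_mat n n" "Q * P = 1\<^sub>m n"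
  shows "fn.op.dim_at_most (op_of_mat n ` {P * A | A. A \<in> alternating_mats n}) (fn.maxdim n)"
    and "fn.op.subspace (op_of_mat n ` {P * A | A. A \<in> alternating_mats n})"
proof -
  let ?X = "{P * A | A. A \<in> alternating_mats n}"
  let ?I = "SIGMA j:{..<n}. {..<j}"
  let ?f = "\<lambda>p N. \<Sum>k<n. Q $$ (snd p, k) * N (unit_fn (fst p)) k"
  have f: "?f (j, i) (op_of_mat n (P * A)) = A $$ (i, j)" if "i < n" "j < n" "A \<in> carrier_mat n n" for i j A
  proof -
    have "?f (j, i) (op_of_mat n (P * A)) = (\<Sum>k<n. Q $$ (i, k) * (P * A) $$ (k, j))"
      using that by (simp add: op_of_mat_unit_fn)
    also have "\<dots> = (Q * (P * A)) $$ (i, j)"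
      using that P Q by (simp add: scalar_prod_def lessThan_atLeast0)
    also have "Q * (P * A) = A"
      using that P Q by (simp flip: assoc_mult_mat)
    finally show ?thesis .
  qed
  show sub: "fn.op.subspace (op_of_mat n ` ?X)"
  proof (rule op_of_mat_subspace)
    show "?X \<subseteq> carrier_mat n n" using mult_carrier_mat[OF P alternatingD(1)] by blast
    have "0\<^sub>m n n \<in> alternating_mats n" by (rule alternatingI) auto
    moreover have "P * 0\<^sub>m n n = 0\<^sub>m n n" using P by simp
    ultimately show "0\<^sub>m n n \<in> ?X" by (intro CollectI exI[of _ "0\<^sub>m n n"]) simp
    fix X assume "X \<in> ?X"
    then obtain A where A: "A \<in> alternating_mats n" "X = P * A" by blast
    note AD = alternatingD[OF A(1)]
    show "c \<cdot>\<^sub>m X \<in> ?X" for c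
    proof -
      have "c \<cdot>\<^sub>m A \<in> alternating_mats n"
      proof (rule alternatingI)
        show "(c \<cdot>\<^sub>m A) $$ (j, i) = - (c \<cdot>\<^sub>m A) $$ (i, j)" if "i < n" "j < n" for i j
          using AD(1) AD(2)[OF that] that by simp
      qed (use AD(1,3) in auto)
      moreover have "c \<cdot>\<^sub>m X = P * (c \<cdot>\<^sub>m A)" unfolding A(2) using mult_smult_distrib[OF P AD(1)] by simp
      ultimately show ?thesis by blast
    qed
    fix Y assume "Y \<in> ?X"
    then obtain B where B: "B \<in> alternating_mats n" "Y = P * B" by blast
    note BD = alternatingD[OF B(1)]
    have "A + B \<in> alternating_mats n"
    proof (rule alternatingI)
      show "(A + B) $$ (j, i) = - (A + B) $$ (i, j)" if "i < n" "j < n" for i j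
        using AD(1) AD(2)[OF that] BD(1) BD(2)[OF that] that by simp
    qed (use AD(1,3) BD(1,3) in auto)
    moreover have "X + Y = P * (A + B)" unfolding A(2) B(2) using P AD(1) BD(1)
      by (simp add: mult_add_distrib_mat)
    ultimately show "X + Y \<in> ?X" by blast
  qed
  have ker: "{N \<in> op_of_mat n ` ?X. \<forall>p\<in>?I. ?f p N = 0} \<subseteq> {0}"
  proof
    fix N assume "N \<in> {N \<in> op_of_mat n ` ?X. \<forall>p\<in>?I. ?f p N = 0}"
    then obtain A where A: "A \<in> alternating_mats n" "N = op_of_mat n (P * A)"
      and z: "\<forall>p\<in>?I. ?f p N = 0" by blast
    note AD = alternatingD[OF A(1)]
    have upper: "A $$ (i, j) = 0" if "i < j" "j < n" for i j
    proof -
      have "?f (j, i) N = 0" using z that by blast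
      then show ?thesis using f[of i j A] that AD(1) A(2) by simp
    qed
    have "A = 0\<^sub>m n n"
    proof (rule eq_matI)
      fix i j assume "i < dim_row (0\<^sub>m n n :: 'a mat)" "j < dim_col (0\<^sub>m n n :: 'a mat)"
      then have ij: "i < n" "j < n" by auto
      have "A $$ (i, j) = 0"
      proof (cases i j rule: linorder_cases)
        case greater
        then show ?thesis using upper[of j i] AD(2)[of j i] ij by simp
      qed (use upper AD(3) ij in auto)
      then show "A $$ (i, j) = 0\<^sub>m n n $$ (i, j)" using ij by simp
    qed (use AD(1) in auto)
    then have "N = op_of_mat n (0\<^sub>m n n)" using A(2) P by simp
    then show "N \<in> {0}" using op_of_mat_zero by simp
  qed
  then have "fn.op.dim_at_most {N \<in> op_of_mat n ` ?X. \<forall>p\<in>?I. ?f p N = 0} 0"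
    by (simp add: fn.op.dim_at_most_zero_iff)
  then have "fn.op.dim_at_most (op_of_mat n ` ?X) (0 + card ?I)"
    by (intro fn.dim_functionals[OF _ sub, of ?I ?f])
      (auto simp: distrib_left sum.distrib sum_distrib_left mult.left_commute)
  moreover have "card ?I = fn.maxdim n" by (simp add: fn.maxdim_sum)
  ultimately show "fn.op.dim_at_most (op_of_mat n ` ?X) (fn.maxdim n)" by simp
qed

lemma third_scalar:
  assumes "infinite (UNIV :: 'a::field set) \<or> card (UNIV :: 'a set) \<ge> 3"
  obtains s :: "'a::field" where "s \<noteq> 0" "s \<noteq> 1"
proof -
  have "\<not> (UNIV :: 'a set) \<subseteq> {0, 1}"
  proof
    assume sub: "(UNIV :: 'a set) \<subseteq> {0, 1}"
    have "card (UNIV :: 'a set) \<le> card {0, 1 :: 'a}" by (rule card_mono[OF _ sub]) simp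
    then have "card (UNIV :: 'a set) \<le> 2" by simp
    moreover have "finite (UNIV :: 'a set)" using sub finite_subset by blast
    ultimately show False using assms by simp
  qed
  then show ?thesis using that by blast
qed

text \<open>Expansion along the unit vectors, by induction on truncations of \<open>u\<close>. The
  argument \<open>w\<close> stays passive, so swapping the arguments of \<open>b\<close> gives the
  expansion on the other side.\<close>

lemma form_coordinates:
  assumes left: "\<And>u v w t. u \<in> coord_space n \<Longrightarrow> v \<in> coord_space n \<Longrightarrow> w \<in> coord_space n \<Longrightarrow>
      b w (u + (\<lambda>i. t * v i)) = b w u + t * b w v"
    and w: "w \<in> coord_space n" and u: "u \<in> coord_space n"
  shows "b w u = (\<Sum>k<n. u k * b w (unit_fn k))"
proof -
  have e: "unit_fn k \<in> coord_space n" if "k < n" for k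
    using that by (auto simp: coord_space_def unit_fn_def)
  have z: "0 \<in> coord_space n" using fn.subspace_0[OF subspace_coord_space] .
  have b0: "b w 0 = 0"
  proof -
    have "(0 :: nat \<Rightarrow> 'a) + (\<lambda>i. (- 1) * 0 i) = 0" by (simp add: fun_eq_iff)
    then show ?thesis using left[OF z z w, of "- 1"] by simp
  qed
  have "b w (truncate_fn j u) = (\<Sum>k<j. u k * b w (unit_fn k)) \<and> truncate_fn j u \<in> coord_space n"
    if "j \<le> n" for j
    using that
  proof (induction j)
    case 0
    have "truncate_fn 0 u = 0" by (simp add: truncate_fn_def fun_eq_iff)
    then show ?case using b0 z by (simp add: zero_fun_def)
  next
    case (Suc j)
    have eq: "truncate_fn (Suc j) u = truncate_fn j u + (\<lambda>i. u j * unit_fn j i)"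
      by (auto simp: truncate_fn_def unit_fn_def fun_eq_iff less_Suc_eq)
    have "truncate_fn (Suc j) u \<in> coord_space n"
      using Suc.prems by (auto simp: truncate_fn_def coord_space_def)
    moreover have "b w (truncate_fn j u + (\<lambda>i. u j * unit_fn j i))
        = b w (truncate_fn j u) + u j * b w (unit_fn j)"
      by (rule left[OF _ e w]) (use Suc in auto)
    then have "b w (truncate_fn (Suc j) u) = b w (truncate_fn j u) + u j * b w (unit_fn j)"
      by (simp only: eq)
    ultimately show ?case using Suc by simp
  qed
  from this[of n] show ?thesis using truncate_props(3)[OF u] by simp
qed

theorem theorem2:
  fixes V :: "'a :: field mat set" and n :: nat
  assumes "n \<ge> 1"
    and "mat_subspace n V"
    and "trivial_spectrum V"
  shows "mat_subspace_dim n V \<le> n * (n - 1) div 2 \<and>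
    (mat_subspace_dim n V = n * (n - 1) div 2 \<longrightarrow>
     infinite (UNIV :: 'a set) \<or> card (UNIV :: 'a set) \<ge> 3 \<longrightarrow>
     irreducible_mats n V \<longrightarrow>
     (\<exists>P \<in> carrier_mat n n. invertible_mat P \<and> V = {P * A | A. A \<in> alternating_mats n}))"
proof (intro conjI impI)
  note VD = mat_subspaceD[OF assms(2)]
  have V_on: "fn.trivial_spectrum_on (coord_space n) (op_of_mat n ` V)" using op_of_mat_trivial_spectrum[OF assms(2,3)] .
  have "fn.op.dim_at_most (op_of_mat n ` V) (fn.maxdim n)"
    using fn.trivial_spectrum_dim_subspace[OF subspace_coord_space coord_space_dim V_on] .
  then show "mat_subspace_dim n V \<le> n * (n - 1) div 2"
    using mat_subspace_dim_le[OF assms(2)] by (simp add: fn.maxdim_def)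
  assume dim: "mat_subspace_dim n V = n * (n - 1) div 2"
    and card: "infinite (UNIV :: 'a set) \<or> card (UNIV :: 'a set) \<ge> 3"
    and irr: "irreducible_mats n V"
  have max: "fn.maxdim n \<le> k" if "fn.op.dim_at_most (op_of_mat n ` V) k" for k
    using mat_subspace_dim_le[OF assms(2) that] dim by (simp add: fn.maxdim_def)
  obtain s :: 'a where s: "s \<noteq> 0" "s \<noteq> 1" using third_scalar[OF card] by blast
  obtain m where m: "n = Suc m" using assms(1) by (cases n) auto
  have op_of_mat_trunc: "N (truncate_fn n v) = N v" if "N \<in> op_of_mat n ` V" for N v
    using that op_of_mat_truncate by auto
  have "\<exists>b. (\<forall>u\<in>coord_space n. \<forall>v\<in>coord_space n. \<forall>w\<in>coord_space n. \<forall>t.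
          b (u + (\<lambda>i. t * v i)) w = b u w + t * b v w) \<and>
      (\<forall>u\<in>coord_space n. \<forall>v\<in>coord_space n. \<forall>w\<in>coord_space n. \<forall>t.
          b w (u + (\<lambda>i. t * v i)) = b w u + t * b w v) \<and>
      (\<forall>M\<in>op_of_mat n ` V. \<forall>u\<in>coord_space n. b u (M u) = 0) \<and>
      (\<forall>v\<in>coord_space n. (\<forall>u\<in>coord_space n. b u v = 0) \<longrightarrow> v = 0)"
    by (rule fn.maximal_irreducible_form[of "coord_space n" m, folded m,
        OF subspace_coord_space coord_space_dim coord_space_dim_min V_on max s
          truncate_props op_of_mat_trunc op_of_mat_irreducible[OF VD(1) irr]])
  then obtain b where b0: "\<forall>u\<in>coord_space n. \<forall>v\<in>coord_space n. \<forall>w\<in>coord_space n. \<forall>t.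
          b (u + (\<lambda>i. t * v i)) w = b u w + t * b v w"
      "\<forall>u\<in>coord_space n. \<forall>v\<in>coord_space n. \<forall>w\<in>coord_space n. \<forall>t.
          b w (u + (\<lambda>i. t * v i)) = b w u + t * b w v"
      "\<forall>M\<in>op_of_mat n ` V. \<forall>u\<in>coord_space n. b u (M u) = 0"
      "\<forall>v\<in>coord_space n. (\<forall>u\<in>coord_space n. b u v = 0) \<longrightarrow> v = 0"
    by (elim exE conjE)
  have b: "\<And>u v w t. u \<in> coord_space n \<Longrightarrow> v \<in> coord_space n \<Longrightarrow> w \<in> coord_space n \<Longrightarrow>
        b (u + (\<lambda>i. t * v i)) w = b u w + t * b v w"
      "\<And>u v w t. u \<in> coord_space n \<Longrightarrow> v \<in> coord_space n \<Longrightarrow> w \<in> coord_space n \<Longrightarrow>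
        b w (u + (\<lambda>i. t * v i)) = b w u + t * b w v"
      "\<And>M u. M \<in> V \<Longrightarrow> u \<in> coord_space n \<Longrightarrow> b u (op_of_mat n M u) = 0"
      "\<And>v. v \<in> coord_space n \<Longrightarrow> (\<And>u. u \<in> coord_space n \<Longrightarrow> b u v = 0) \<Longrightarrow> v = 0"
    using b0 by simp_all
  have e: "unit_fn k \<in> coord_space n" if "k < n" for k
    using that by (auto simp: coord_space_def unit_fn_def)
  \<comment> \<open>\<open>Q\<close> is the Gram matrix of the form, so the entries of Q M are
    b(e_i, M e_j), and b(u, M u) = 0 says that Q M is alternating.\<close>
  define Q where "Q = mat n n (\<lambda>(i, j). b (unit_fn i) (unit_fn j))"
  have Q: "Q \<in> carrier_mat n n" by (simp add: Q_def)
  have QM: "(Q * M) $$ (i, j) = b (unit_fn i) (op_of_mat n M (unit_fn j))"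
    if "M \<in> V" "i < n" "j < n" for M i j
  proof -
    have M: "M \<in> carrier_mat n n" using that VD(1) by blast
    have "b (unit_fn i) (op_of_mat n M (unit_fn j))
        = (\<Sum>k<n. op_of_mat n M (unit_fn j) k * b (unit_fn i) (unit_fn k))"
      by (rule form_coordinates[OF b(2) e[OF that(2)] op_of_mat_coord_space])
    also have "\<dots> = (Q * M) $$ (i, j)"
      using that M by (simp add: Q_def scalar_prod_def lessThan_atLeast0 op_of_mat_unit_fn mult.commute)
    finally show ?thesis ..
  qed
  have QM_alt: "Q * M \<in> alternating_mats n" if M: "M \<in> V" for M
  proof (rule alternatingI)
    show "Q * M \<in> carrier_mat n n" using Q VD(1) M by auto
    show "(Q * M) $$ (i, i) = 0" if "i < n" for i using QM[OF M that that] b(3)[OF M e[OF that]] by simp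
    show "(Q * M) $$ (j, i) = - (Q * M) $$ (i, j)" if ij: "i < n" "j < n" for i j
    proof -
      let ?ei = "unit_fn i :: nat \<Rightarrow> 'a" and ?ej = "unit_fn j :: nat \<Rightarrow> 'a"
      have Mc: "op_of_mat n M f \<in> coord_space n" for f by (rule op_of_mat_coord_space)
      have sum: "?ei + (\<lambda>k. 1 * ?ej k) \<in> coord_space n"
        using fn.subspace_add[OF subspace_coord_space e[OF ij(1)] e[OF ij(2)]] by (simp add: plus_fun_def)
      have Msum: "op_of_mat n M (?ei + (\<lambda>k. 1 * ?ej k)) = op_of_mat n M ?ei + (\<lambda>k. 1 * op_of_mat n M ?ej k)"
        using fn.lin_add[OF op_of_mat_lin, of n M ?ei "\<lambda>k. 1 * ?ej k"] by simp
      have w: "op_of_mat n M ?ei + (\<lambda>k. 1 * op_of_mat n M ?ej k) \<in> coord_space n"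
        using fn.subspace_add[OF subspace_coord_space Mc[of ?ei] Mc[of ?ej]] by (simp add: plus_fun_def)
      have "b (?ei + (\<lambda>k. 1 * ?ej k)) (op_of_mat n M (?ei + (\<lambda>k. 1 * ?ej k))) = 0"
        using b(3)[OF M sum] .
      then have "b ?ei (op_of_mat n M ?ei) + b ?ei (op_of_mat n M ?ej) + (b ?ej (op_of_mat n M ?ei) + b ?ej (op_of_mat n M ?ej)) = 0"
        unfolding Msum b(1)[OF e[OF ij(1)] e[OF ij(2)] w] b(2)[OF Mc Mc e[OF ij(1)]] b(2)[OF Mc Mc e[OF ij(2)]]
        by simp
      then show ?thesis
        using b(3)[OF M e[OF ij(1)]] b(3)[OF M e[OF ij(2)]] QM[OF M ij] QM[OF M ij(2,1)]
        by (simp add: eq_neg_iff_add_eq_0 add.commute)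
    qed
  qed
  \<comment> \<open>A nonzero kernel vector of \<open>Q\<close> would be orthogonal from the right
    to all unit vectors, hence to everything, against nondegeneracy.\<close>
  have "det Q \<noteq> 0"
  proof
    assume "det Q = 0"
    then obtain v where v: "v \<in> carrier_vec n" "v \<noteq> 0\<^sub>v n" "Q *\<^sub>v v = 0\<^sub>v n"
      using det_0_iff_vec_prod_zero[OF Q] by blast
    define f where "f i = (if i < n then v $ i else 0)" for i
    have f: "f \<in> coord_space n" by (simp add: f_def coord_space_def)
    have bf: "b (unit_fn i) f = 0" if "i < n" for i
    proof -
      have "b (unit_fn i) f = (\<Sum>k<n. f k * b (unit_fn i) (unit_fn k))"
        by (rule form_coordinates[OF b(2) e[OF that] f])
      also have "\<dots> = (Q *\<^sub>v v) $ i"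
        using that v(1) by (simp add: Q_def scalar_prod_def lessThan_atLeast0 f_def mult.commute)
      finally show ?thesis using v(3) that by simp
    qed
    have "b u f = 0" if u: "u \<in> coord_space n" for u
    proof -
      have "b u f = (\<Sum>k<n. u k * b (unit_fn k) f)"
        by (rule form_coordinates[of n "\<lambda>w u. b u w", OF b(1) f u])
      then show ?thesis using bf by simp
    qed
    then have "f = 0" using b(4)[OF f] by blast
    then have "f i = 0" for i by simp
    then have "v $ i = 0" if "i < n" for i using that by (metis f_def)
    then have "v = 0\<^sub>v n" using v(1) by (intro eq_vecI) auto
    then show False using v(2) by simp
  qed
  then obtain P where P: "P \<in> carrier_mat n n" "P * Q = 1\<^sub>m n" "Q * P = 1\<^sub>m n"
    using det_non_zero_imp_unit[OF Q, of "()"] unfolding Units_def ring_mat_simps by auto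
  have inv: "invertible_mat P"
    unfolding invertible_mat_def inverts_mat_def using P Q by auto
  let ?X = "{P * A | A. A \<in> alternating_mats n}"
  have VX: "V \<subseteq> ?X"
  proof
    fix M assume M: "M \<in> V"
    have "P * (Q * M) = M" using P Q VD(1) M by (auto simp flip: assoc_mult_mat)
    then show "M \<in> ?X" using QM_alt[OF M] by (intro CollectI exI[of _ "Q * M"]) simp
  qed
  note X = alternating_image_dim[OF P(1) Q P(3)]
  \<comment> \<open>Both spaces are bounded by \<open>maxdim n\<close>, and a strict inclusion would
    give \<open>V\<close> a smaller bound than its extremality permits.\<close>
  have eq: "op_of_mat n ` V = op_of_mat n ` ?X"
  proof (rule ccontr)
    assume "op_of_mat n ` V \<noteq> op_of_mat n ` ?X"
    then have "op_of_mat n ` V \<subset> op_of_mat n ` ?X" using VX by blast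
    then obtain j where "fn.maxdim n = Suc j" "fn.op.dim_at_most (op_of_mat n ` V) j"
      using fn.op.dim_at_most_psubset[OF op_of_mat_subspace[OF VD] _ X(1)] by blast
    then show False using max[of j] by simp
  qed
  have "?X \<subseteq> V"
  proof
    fix Y assume Y: "Y \<in> ?X"
    then have "op_of_mat n Y \<in> op_of_mat n ` V" unfolding eq by (rule imageI)
    then obtain M where M: "M \<in> V" "op_of_mat n Y = op_of_mat n M" by (elim imageE)
    have "Y \<in> carrier_mat n n" using Y mult_carrier_mat[OF P(1) alternatingD(1)] by blast
    then have "Y = M" using op_of_mat_inj[of Y n M] M VD(1) by blast
    then show "Y \<in> V" using M(1) by simp
  qed
  then show "\<exists>P \<in> carrier_mat n n. invertible_mat P \<and> V = {P * A | A. A \<in> alternating_mats n}"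
    using P(1) inv VX by blast
qed

end
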